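(* Let $N\ge3$, $1<p<\frac{N+2}{N-2}$ and fix $R\in(0,1)$. For each $\alpha>0$ let $u_\alpha$ be a positive groundstate solution of $(\mathcal P)$ with weight $V_{R,\alpha}$, and let $\beta_\alpha:=\max_{\overline B}u_\alpha=u_\alpha(x_\alpha)$ where $x_\alpha=(s_\alpha,0,\dots,0)$ with $s_\alpha\in[0,1)$. Assume $$\liminf_{\alpha\to\infty}\alpha^{\frac{2}{p-1}}\beta_\alpha^{-1}<\infty.$$ Then the family $(x_\alpha)$ has at most two accumulation points as $\alpha\to\infty$, namely the origin and/or $(1,0,\dots,0)$.
   Context: Let $B=B(0,1)\subset\mathbb R^N$. For $\alpha>0$ and $R\in(0,1)$ the radial weight $V_{R,\alpha}$ is $V(r)=(1-r/R)^\alpha$ for $0\le r<R$ and $V(r)=\left(1-\frac{1-r}{1-R}\right)^\alpha$ for $R\le r\le1$. Problem $(\mathcal P)$: $-\Delta u=V(|x|)|u|^{p-1}u$ in $B$, $u=0$ on $\partial B$. A groundstate is $u_\alpha=S_\alpha^{1/(p-1)}u^*_\alpha$ where $u^*_\alpha$ is a positive minimiser of $S_\alpha=\inf_{0\ne u\in H^1_0(B)}\frac{\int_B|Du|^2}{(\int_BV|u|^{p+1})^{2/(p+1)}}$ with $\int_BV|u^*_\alpha|^{p+1}=1$. Groundstates are foliated Schwarz symmetric, so after a rotation the maximum is attained on the positive $x_1$-semi-axis, as assumed. *)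

theory Defs
  imports "HOL-Analysis.Analysis"
begin

text \<open>The radial weight V_{R,alpha}, as a function of r = |x|, for 0 <= r <= 1.\<close>
definition Vw :: "real \<Rightarrow> real \<Rightarrow> real \<Rightarrow> real" where
  "Vw R \<alpha> r = (if r < R then (1 - r / R) powr \<alpha>
                 else (1 - (1 - r) / (1 - R)) powr \<alpha>)"

definition Cc1_ball :: "(real^'n \<Rightarrow> real) \<Rightarrow> (real^'n \<Rightarrow> real^'n) \<Rightarrow> bool" where
  "Cc1_ball \<phi> d\<phi> \<longleftrightarrow>
     (\<forall>x. (\<phi> has_derivative (\<lambda>h. d\<phi> x \<bullet> h)) (at x)) \<and> continuous_on UNIV d\<phi> \<and>
     (\<exists>K. compact K \<and> K \<subseteq> ball 0 1 \<and> (\<forall>x. x \<notin> K \<longrightarrow> \<phi> x = 0))"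

text \<open>H^1_0(B): u (extended by zero outside B) with weak gradient g is the
  H^1-limit of C^1_c(B) functions (closure of C^1_c(B) in the H^1 norm).\<close>
definition H10 :: "(real^'n \<Rightarrow> real) \<Rightarrow> (real^'n \<Rightarrow> real^'n) \<Rightarrow> bool" where
  "H10 u g \<longleftrightarrow>
     (\<forall>x. x \<notin> ball 0 1 \<longrightarrow> u x = 0) \<and>
     u \<in> borel_measurable lborel \<and> integrable lborel (\<lambda>x. (u x)\<^sup>2) \<and>
     g \<in> borel_measurable lborel \<and> integrable lborel (\<lambda>x. (norm (g x))\<^sup>2) \<and>
     (\<exists>\<phi> d\<phi>. (\<forall>k. Cc1_ball (\<phi> k) (d\<phi> k)) \<and>
        (\<lambda>k. LINT x|lborel. (\<phi> k x - u x)\<^sup>2) \<longlonglongrightarrow> 0 \<and>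
        (\<lambda>k. LINT x|lborel. (norm (d\<phi> k x - g x))\<^sup>2) \<longlonglongrightarrow> 0)"

definition dirichlet :: "(real^'n \<Rightarrow> real^'n) \<Rightarrow> real" where
  "dirichlet g = (LINT x|lborel. (norm (g x))\<^sup>2)"

definition wterm :: "real \<Rightarrow> real \<Rightarrow> real \<Rightarrow> (real^'n \<Rightarrow> real) \<Rightarrow> real" where
  "wterm R \<alpha> p u = (LINT x|lborel. Vw R \<alpha> (norm x) * \<bar>u x\<bar> powr (p + 1))"

definition rayleigh :: "real \<Rightarrow> real \<Rightarrow> real \<Rightarrow> (real^'n \<Rightarrow> real) \<Rightarrow> (real^'n \<Rightarrow> real^'n) \<Rightarrow> real" where
  "rayleigh R \<alpha> p u g = dirichlet g / (wterm R \<alpha> p u) powr (2 / (p + 1))"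

definition S_const :: "('n::finite) itself \<Rightarrow> real \<Rightarrow> real \<Rightarrow> real \<Rightarrow> real" where
  "S_const _ R \<alpha> p = Inf {rayleigh R \<alpha> p u g | (u :: real^('n::finite) \<Rightarrow> real) g.
                          H10 u g \<and> \<not> (AE x in lborel. u x = 0)}"

text \<open>u is a positive minimiser u*_alpha of S_alpha, normalised by \<integral> V|u|^(p+1) = 1
  (taken as its continuous representative on the closed ball).\<close>
definition pos_minimiser :: "real \<Rightarrow> real \<Rightarrow> real \<Rightarrow> (real^'n \<Rightarrow> real) \<Rightarrow> bool" where
  "pos_minimiser R \<alpha> p u \<longleftrightarrow>
     (\<exists>g. H10 u g \<and> wterm R \<alpha> p u = 1 \<and>
          rayleigh R \<alpha> p u g = S_const TYPE('n) R \<alpha> p) \<and>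
     continuous_on (cball 0 1) u \<and> (\<forall>x\<in>ball 0 1. u x > 0)"

definition groundstate :: "real \<Rightarrow> real \<Rightarrow> real \<Rightarrow> (real^'n \<Rightarrow> real) \<Rightarrow> bool" where
  "groundstate R \<alpha> p u \<longleftrightarrow>
     (\<exists>ustar. pos_minimiser R \<alpha> p ustar \<and>
        u = (\<lambda>x. S_const TYPE('n) R \<alpha> p powr (1 / (p - 1)) * ustar x))"

end

theory Submission
  imports Defs
begin

text \<open>
  Let \<open>w\<close> be the normalised minimiser, \<open>S\<close> the infimum and \<open>M = max w\<close>. Both Hardy inequalities (at the
  origin and at the boundary) give \<open>\<integral> V w\<^sup>2 \<le> C S / \<alpha>\<^sup>2\<close>, hence \<open>\<alpha>\<^sup>2 \<le> C S M\<^bsup>p-1\<^esup>\<close>, while a bump of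
  width \<open>1/\<alpha>\<close> at the origin gives \<open>S \<le> C \<alpha>\<^sup>\<gamma>\<close> with \<open>\<gamma>(p+1)/2 = 2 - (N-2)(p-1)/2 < 2\<close>.
  If the maximum is attained at a point \<open>x\<^sub>0\<close> at distance at least \<open>2d\<close> from the origin and from the boundary, then
  \<open>V\<close> is exponentially small on \<open>B(x\<^sub>0, d)\<close>. Testing the equation with a truncated fundamental
  solution centred at \<open>x\<^sub>0\<close>, \<open>M\<close> is bounded by an average of \<open>w\<close>, which Poincare's inequality controls by
  \<open>C S\<^bsup>1/2\<^esup>\<close>, plus a Newtonian potential of \<open>S V w\<^sup>p\<close> over \<open>B(x\<^sub>0, d)\<close>. Subcriticality makes the latter, by
  Young's inequality and \<open>\<integral> V w\<^bsup>p+1\<^esup> = 1\<close>, negligible compared with \<open>M\<close>. So \<open>M \<le> C S\<^bsup>1/2\<^esup>\<close>, and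
  \<open>\<alpha>\<^sup>2 \<le> C S\<^bsup>(p+1)/2\<^esup> \<le> C \<alpha>\<^bsup>\<gamma>(p+1)/2\<^esup>\<close> fails for large \<open>\<alpha>\<close>.
\<close>

text \<open>The threshold for \<alpha> must not depend on the minimiser, of which only continuity on
  the closed ball and membership in H^1_0 are at hand. The equation therefore enters only as an
  inequality tested with a nonnegative explicit function of t = |x - x_0|^2. Hardy weights and
  fundamental solution are regularised by a parameter e, and the bounds are uniform in it; near x_0
  it is chosen after w, by continuity.

  Young's inequality is applied to w^m times the kernel, the rest w^(p-m) being bounded by M^(p-m).
  Two demands fix m. The conjugate power of |x - x_0|^(2-N) is locally integrable iff m < 2(p+1)/N.
  The resulting term S M^(p-m) can be absorbed by M if m > p - 1, because the lower bound on M turns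
  M^(p-1-m) into a power of S. The two are compatible exactly when p is subcritical. Powers of S are
  at most powers of \<alpha>, and the exponential smallness of V beats them; the free parameter in
  Young's inequality distributes that smallness over both terms.\<close>

section \<open>Integration by parts and L2 limits\<close>

lemma integrable_continuous_compact_support:
  fixes f :: "'a::euclidean_space \<Rightarrow> 'b::{banach, second_countable_topology}"
  assumes "continuous_on UNIV f" "compact K" "\<And>x. x \<notin> K \<Longrightarrow> f x = 0"
  shows "integrable lborel f"
proof -
  have "(\<lambda>x. indicator K x *\<^sub>R f x) = f"
    using assms(3) by (auto simp: fun_eq_iff indicator_def)
  then show ?thesis
    using borel_integrable_compact[OF assms(2) continuous_on_subset[OF assms(1)]] by simp
qed

lemma bounded_continuous_compact_support:
  fixes f :: "'a::topological_space \<Rightarrow> 'b::real_normed_vector"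
  assumes "continuous_on UNIV f" "compact K" "\<And>x. x \<notin> K \<Longrightarrow> f x = 0"
  obtains C where "C \<ge> 0" "\<And>x. norm (f x) \<le> C"
proof -
  have "bounded (f ` K)"
    by (intro compact_imp_bounded compact_continuous_image continuous_on_subset[OF assms(1)] assms(2)) simp
  then obtain C where C: "\<And>x. x \<in> K \<Longrightarrow> norm (f x) \<le> C"
    by (auto simp: bounded_iff)
  have "norm (f x) \<le> max 0 C" for x
    using C[of x] assms(3)[of x] by (cases "x \<in> K") auto
  then show ?thesis using that[of "max 0 C"] by auto
qed

lemma continuous_on_UNIV_zero_extension:
  fixes f :: "'a::topological_space \<Rightarrow> 'b::{zero,topological_space}"
  assumes "closed K" "open U" "K \<subseteq> U" "continuous_on U f" "\<And>x. x \<notin> K \<Longrightarrow> f x = 0"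
  shows "continuous_on UNIV f"
proof -
  have "continuous_on (- K) f"
    by (rule continuous_on_eq[of _ "\<lambda>_. 0"]) (use assms(5) in auto)
  then have "continuous_on (U \<union> - K) f"
    using assms by (intro continuous_on_open_Un) auto
  moreover have "U \<union> - K = UNIV" using assms(3) by auto
  ultimately show ?thesis by simp
qed

lemma gradient_zero_outside_support:
  fixes f :: "'a::euclidean_space \<Rightarrow> real"
  assumes "(f has_derivative (\<lambda>h. v \<bullet> h)) (at x)" "closed K" "\<And>x. x \<notin> K \<Longrightarrow> f x = 0" "x \<notin> K"
  shows "v = 0"
proof -
  have "(f has_derivative (\<lambda>h. 0)) (at x)"
    by (rule has_derivative_transform_within_open[of "\<lambda>_. 0" _ _ _ "- K"])
       (use assms in auto)
  then have "(\<lambda>h. v \<bullet> h) = (\<lambda>h. 0)"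
    using assms(1) has_derivative_unique by blast
  then have "v \<bullet> v = 0" by metis
  then show ?thesis by simp
qed

lemma lborel_integral_translation:
  fixes f :: "'a::euclidean_space \<Rightarrow> real"
  assumes [measurable]: "f \<in> borel_measurable borel"
  shows "(LINT x|lborel. f (c + x)) = (LINT x|lborel. f x)"
proof -
  have "distr lborel borel (\<lambda>x. c + x) = lborel"
    using lborel_affine[of 1 c] by (simp add: density_1)
  then have "(LINT x|lborel. f x) = (LINT x|distr lborel borel (\<lambda>x. c + x). f x)" by simp
  also have "\<dots> = (LINT x|lborel. f (c + x))" by (subst integral_distr) auto
  finally show ?thesis by simp
qed

text \<open>The translates of \<open>f\<close> have the same integral; differentiate in the translation.\<close>

lemma integral_gradient_zero:
  fixes f :: "'a::euclidean_space \<Rightarrow> real"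
  assumes der: "\<And>x. (f has_derivative (\<lambda>h. df x \<bullet> h)) (at x)"
    and cont: "continuous_on UNIV df"
    and K: "compact K" "\<And>x. x \<notin> K \<Longrightarrow> f x = 0"
  shows "(LINT x|lborel. df x \<bullet> b) = 0"
proof -
  have contf: "continuous_on UNIV f"
    by (intro continuous_at_imp_continuous_on ballI has_derivative_continuous[OF der])
  have [measurable]: "f \<in> borel_measurable borel" "df \<in> borel_measurable borel"
    using contf cont borel_measurable_continuous_onI by blast+
  have df0: "df x = 0" if "x \<notin> K" for x
    using gradient_zero_outside_support[OF der compact_imp_closed[OF K(1)] K(2) that] by blast
  obtain C where C: "C \<ge> 0" "\<And>x. norm (df x) \<le> C"
    using bounded_continuous_compact_support[OF cont K(1) df0] by blast
  obtain r where r: "\<And>x. x \<in> K \<Longrightarrow> norm x \<le> r"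
    using K(1) compact_imp_bounded bounded_iff by metis
  define F where "F n x = (f (x + (1 / real (Suc n)) *\<^sub>R b) - f x) * real (Suc n)" for n x
  have lip: "\<bar>f y - f x\<bar> \<le> C * norm (y - x)" for x y
  proof -
    have "norm (f y - f x) \<le> C * norm (y - x)"
    proof (rule differentiable_bound[of UNIV f "\<lambda>x h. df x \<bullet> h"])
      fix x show "onorm (\<lambda>h. df x \<bullet> h) \<le> C"
        by (rule onorm_bound) (use C in \<open>auto intro!: order_trans[OF Cauchy_Schwarz_ineq2] mult_right_mono\<close>)
    qed (use der in auto)
    then show ?thesis by simp
  qed
  have bd: "\<bar>F n x\<bar> \<le> C * norm b" for n x
  proof -
    have "norm ((x + (1 / real (Suc n)) *\<^sub>R b) - x) = norm b / real (Suc n)" by simp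
    then have "\<bar>f (x + (1 / real (Suc n)) *\<^sub>R b) - f x\<bar> * real (Suc n) \<le> C * (norm b / real (Suc n)) * real (Suc n)"
      using lip[of "x + (1 / real (Suc n)) *\<^sub>R b" x] by (intro mult_right_mono) auto
    then show ?thesis unfolding F_def abs_mult by simp
  qed
  have "(\<lambda>n. integral\<^sup>L lborel (F n)) \<longlonglongrightarrow> integral\<^sup>L lborel (\<lambda>x. df x \<bullet> b)"
  proof (rule integral_dominated_convergence)
    \<comment> \<open>Each step has length at most \<open>norm b\<close>, so all difference
      quotients vanish outside the ball of radius \<open>r + norm b\<close>; their height is bounded
      by the Lipschitz constant \<open>C\<close> times \<open>norm b\<close>.\<close>
    show "integrable lborel (\<lambda>x::'a. indicator (cball 0 (r + norm b)) x *\<^sub>R (C * norm b))"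
      by (rule borel_integrable_compact) auto
    show "AE x in lborel. (\<lambda>n. F n x) \<longlonglongrightarrow> df x \<bullet> b"
    proof (rule AE_I2)
      fix x
      have "((\<lambda>t. f (x + t *\<^sub>R b)) has_derivative (\<lambda>t. df x \<bullet> (t *\<^sub>R b))) (at 0)"
        by (rule has_derivative_compose[of "\<lambda>t. x + t *\<^sub>R b" "\<lambda>t. t *\<^sub>R b" _ _ f "\<lambda>h. df x \<bullet> h"])
           (auto intro!: derivative_eq_intros simp: der)
      then have "((\<lambda>t. f (x + t *\<^sub>R b)) has_real_derivative (df x \<bullet> b)) (at 0)"
        unfolding has_field_derivative_def by (rule has_derivative_eq_rhs) auto
      then have lim: "((\<lambda>h. (f (x + h *\<^sub>R b) - f x) / h) \<longlongrightarrow> df x \<bullet> b) (at 0)"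
        by (simp add: DERIV_def)
      have "filterlim (\<lambda>n. 1 / real (Suc n)) (at 0) sequentially"
        unfolding filterlim_at using LIMSEQ_inverse_real_of_nat by (auto simp: inverse_eq_divide)
      from filterlim_compose[OF lim this] show "(\<lambda>n. F n x) \<longlonglongrightarrow> df x \<bullet> b"
        by (simp add: F_def)
    qed
    show "AE x in lborel. norm (F n x) \<le> indicator (cball 0 (r + norm b)) x *\<^sub>R (C * norm b)" for n
    proof (rule AE_I2)
      fix x
      show "norm (F n x) \<le> indicator (cball 0 (r + norm b)) x *\<^sub>R (C * norm b)"
      proof (cases "norm x \<le> r + norm b")
        case True then show ?thesis using bd by simp
      next
        case False
        have "norm ((1 / real (Suc n)) *\<^sub>R b) \<le> norm b"
          by (simp add: divide_le_eq mult_left_le_one_le field_simps)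
        moreover have "norm x \<le> norm (x + (1 / real (Suc n)) *\<^sub>R b) + norm ((1 / real (Suc n)) *\<^sub>R b)"
          using norm_triangle_ineq4[of "x + (1 / real (Suc n)) *\<^sub>R b" "(1 / real (Suc n)) *\<^sub>R b"] by simp
        ultimately have "x + (1 / real (Suc n)) *\<^sub>R b \<notin> K"
          using False r[of "x + (1 / real (Suc n)) *\<^sub>R b"] by linarith
        moreover have "x \<notin> K" using False r[of x] norm_ge_zero[of b] by linarith
        ultimately have "F n x = 0" using K(2) by (simp add: F_def)
        then show ?thesis using C by simp
      qed
    qed
  qed (simp_all add: F_def[abs_def])
  moreover have "integral\<^sup>L lborel (F n) = 0" for n
  proof -
    have i: "integrable lborel f" by (rule integrable_continuous_compact_support[OF contf K])
    let ?c = "(1 / real (Suc n)) *\<^sub>R b"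
    have "integrable (distr lborel borel (\<lambda>x. ?c + x)) f"
      using i lborel_affine[of 1 ?c] by (simp add: density_1)
    then have i2: "integrable lborel (\<lambda>x. f (?c + x))"
      by (subst (asm) integrable_distr_eq) auto
    have "integral\<^sup>L lborel (F n) = ((LINT x|lborel. f (?c + x)) - (LINT x|lborel. f x)) * real (Suc n)"
      unfolding F_def using i i2 by (simp add: add.commute)
    then show ?thesis by (simp add: lborel_integral_translation)
  qed
  ultimately show ?thesis
    using LIMSEQ_unique[of "\<lambda>n. integral\<^sup>L lborel (F n)"] by simp
qed

text \<open>Divergence theorem for the field \<open>\<psi> x *\<^sub>R (x - c)\<close>, summed over
  coordinates; the dimension is the divergence of \<open>x - c\<close>. Every later integration by
  parts uses a field pointing away from a fixed centre, so this form serves them all.\<close>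

lemma integral_radial_derivative:
  fixes \<psi> :: "'a::euclidean_space \<Rightarrow> real"
  assumes der: "\<And>x. (\<psi> has_derivative (\<lambda>h. d\<psi> x \<bullet> h)) (at x)"
    and cont: "continuous_on UNIV d\<psi>"
    and K: "compact K" "\<And>x. x \<notin> K \<Longrightarrow> \<psi> x = 0"
  shows "(LINT x|lborel. d\<psi> x \<bullet> (x - c)) = - real DIM('a) * (LINT x|lborel. \<psi> x)"
proof -
  have cont\<psi>: "continuous_on UNIV \<psi>"
    by (intro continuous_at_imp_continuous_on ballI has_derivative_continuous[OF der])
  have d0: "d\<psi> x = 0" if "x \<notin> K" for x
    using gradient_zero_outside_support[OF der compact_imp_closed[OF K(1)] K(2) that] by blast
  have i1: "integrable lborel (\<lambda>x. (d\<psi> x \<bullet> b) * ((x - c) \<bullet> b))" for b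
    by (rule integrable_continuous_compact_support[OF _ K(1)])
       (auto intro!: continuous_intros cont simp: d0)
  have i2: "integrable lborel \<psi>" by (rule integrable_continuous_compact_support[OF cont\<psi> K])
  have eq: "(LINT x|lborel. (d\<psi> x \<bullet> b) * ((x - c) \<bullet> b)) = - (LINT x|lborel. \<psi> x)"
    if "b \<in> Basis" for b
  proof -
    have "(LINT x|lborel. (((x - c) \<bullet> b) *\<^sub>R d\<psi> x + \<psi> x *\<^sub>R b) \<bullet> b) = 0"
    proof (rule integral_gradient_zero[OF _ _ K(1)])
      fix x
      show "((\<lambda>x. \<psi> x * ((x - c) \<bullet> b)) has_derivative
              (\<lambda>h. (((x - c) \<bullet> b) *\<^sub>R d\<psi> x + \<psi> x *\<^sub>R b) \<bullet> h)) (at x)"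
        by (auto intro!: derivative_eq_intros der simp: algebra_simps inner_commute)
    qed (auto intro!: continuous_intros cont cont\<psi> simp: K)
    moreover have "(((x - c) \<bullet> b) *\<^sub>R d\<psi> x + \<psi> x *\<^sub>R b) \<bullet> b = (d\<psi> x \<bullet> b) * ((x - c) \<bullet> b) + \<psi> x" for x
      using that by (simp add: inner_add_left)
    ultimately show ?thesis using i1[of b] i2 by simp
  qed
  have "(LINT x|lborel. d\<psi> x \<bullet> (x - c)) = (LINT x|lborel. (\<Sum>b\<in>Basis. (d\<psi> x \<bullet> b) * ((x - c) \<bullet> b)))"
    by (subst euclidean_inner) simp
  also have "\<dots> = (\<Sum>b\<in>(Basis::'a set). - (LINT x|lborel. \<psi> x))"
    using i1 eq by (subst Bochner_Integration.integral_sum) auto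
  finally show ?thesis by simp
qed

section \<open>Pairings and quadratic forms under convergence in L2\<close>

lemma integrable_inner_L2:
  fixes f h :: "'a \<Rightarrow> 'b::euclidean_space"
  assumes [measurable]: "f \<in> borel_measurable M" "h \<in> borel_measurable M"
    and "integrable M (\<lambda>x. (norm (f x))\<^sup>2)" "integrable M (\<lambda>x. (norm (h x))\<^sup>2)"
  shows "integrable M (\<lambda>x. f x \<bullet> h x)"
proof (rule Bochner_Integration.integrable_bound)
  show "integrable M (\<lambda>x. (norm (f x))\<^sup>2 + (norm (h x))\<^sup>2)" using assms by simp
  have "\<bar>f x \<bullet> h x\<bar> \<le> (norm (f x))\<^sup>2 + (norm (h x))\<^sup>2" for x
    using Cauchy_Schwarz_ineq2[of "f x" "h x"] sum_squares_bound[of "norm (f x)" "norm (h x)"]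
      mult_nonneg_nonneg[OF norm_ge_zero[of "f x"] norm_ge_zero[of "h x"]]
    by linarith
  then show "AE x in M. norm (f x \<bullet> h x) \<le> norm ((norm (f x))\<^sup>2 + (norm (h x))\<^sup>2)"
    by simp
qed simp

lemma integrable_add_L2:
  fixes f h :: "'a \<Rightarrow> 'b::euclidean_space"
  assumes [measurable]: "f \<in> borel_measurable M" "h \<in> borel_measurable M"
    and "integrable M (\<lambda>x. (norm (f x))\<^sup>2)" "integrable M (\<lambda>x. (norm (h x))\<^sup>2)"
  shows "integrable M (\<lambda>x. (norm (f x + h x))\<^sup>2)"
    and "(LINT x|M. (norm (f x + h x))\<^sup>2) =
          (LINT x|M. (norm (f x))\<^sup>2) + 2 * (LINT x|M. f x \<bullet> h x) + (LINT x|M. (norm (h x))\<^sup>2)"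
proof -
  have eq: "(norm (f x + h x))\<^sup>2 = (norm (f x))\<^sup>2 + 2 * (f x \<bullet> h x) + (norm (h x))\<^sup>2" for x
    by (simp add: power2_norm_eq_inner inner_add_left inner_add_right inner_commute)
  show "integrable M (\<lambda>x. (norm (f x + h x))\<^sup>2)"
    unfolding eq using assms integrable_inner_L2[OF assms] by simp
  show "(LINT x|M. (norm (f x + h x))\<^sup>2) =
          (LINT x|M. (norm (f x))\<^sup>2) + 2 * (LINT x|M. f x \<bullet> h x) + (LINT x|M. (norm (h x))\<^sup>2)"
    unfolding eq using assms integrable_inner_L2[OF assms] by simp
qed

lemma integral_Cauchy_Schwarz:
  fixes f h :: "'a \<Rightarrow> 'b::euclidean_space"
  assumes [measurable]: "f \<in> borel_measurable M" "h \<in> borel_measurable M"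
    and "integrable M (\<lambda>x. (norm (f x))\<^sup>2)" "integrable M (\<lambda>x. (norm (h x))\<^sup>2)"
  shows "\<bar>LINT x|M. f x \<bullet> h x\<bar> \<le> sqrt (LINT x|M. (norm (f x))\<^sup>2) * sqrt (LINT x|M. (norm (h x))\<^sup>2)"
proof -
  define A B D where "A = (LINT x|M. (norm (f x))\<^sup>2)" and "B = (LINT x|M. f x \<bullet> h x)"
    and "D = (LINT x|M. (norm (h x))\<^sup>2)"
  have nn: "A \<ge> 0" "D \<ge> 0" by (auto simp: A_def D_def)
  have q: "0 \<le> A + 2 * l * B + l\<^sup>2 * D" for l
  proof -
    have 1: "integrable M (\<lambda>x. (norm (l *\<^sub>R h x))\<^sup>2)"
      using assms(4) by (simp add: power_mult_distrib)
    have "(LINT x|M. (norm (f x + l *\<^sub>R h x))\<^sup>2) = A + 2 * l * B + l\<^sup>2 * D"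
      using integrable_add_L2(2)[OF assms(1) _ assms(3) 1]
      by (simp add: A_def B_def D_def power_mult_distrib)
    moreover have "0 \<le> (LINT x|M. (norm (f x + l *\<^sub>R h x))\<^sup>2)" by simp
    ultimately show ?thesis by simp
  qed
  have "B\<^sup>2 \<le> A * D"
  proof (cases "D = 0")
    case True
    have "B = 0"
    proof (rule ccontr)
      assume "B \<noteq> 0"
      \<comment> \<open>At this \<open>l\<close> the quadratic form, which is affine because
        \<open>D = 0\<close>, takes the value -1.\<close>
      then show False using q[of "- (A + 1) / (2 * B)"] True nn by (simp add: field_simps)
    qed
    then show ?thesis using True by simp
  next
    case False
    then have D: "D > 0" using nn by simp
    have "0 \<le> (A + 2 * (- B / D) * B + (- B / D)\<^sup>2 * D) * D"
      using q[of "- B / D"] D by simp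
    also have "\<dots> = A * D - B\<^sup>2" using D by (simp add: field_simps power2_eq_square)
    finally show ?thesis by simp
  qed
  then have "sqrt (B\<^sup>2) \<le> sqrt (A * D)" by (rule real_sqrt_le_mono)
  then show ?thesis by (simp add: A_def B_def D_def real_sqrt_mult)
qed

lemma L2_tendsto_inner:
  fixes f :: "nat \<Rightarrow> 'a \<Rightarrow> 'b::euclidean_space"
  assumes [measurable]: "\<And>k. f k \<in> borel_measurable M" "u \<in> borel_measurable M" "h \<in> borel_measurable M"
    and f: "\<And>k. integrable M (\<lambda>x. (norm (f k x))\<^sup>2)" and u: "integrable M (\<lambda>x. (norm (u x))\<^sup>2)"
    and h: "integrable M (\<lambda>x. (norm (h x))\<^sup>2)"
    and lim: "(\<lambda>k. LINT x|M. (norm (f k x - u x))\<^sup>2) \<longlonglongrightarrow> 0"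
  shows "(\<lambda>k. LINT x|M. f k x \<bullet> h x) \<longlonglongrightarrow> (LINT x|M. u x \<bullet> h x)"
proof -
  have d: "integrable M (\<lambda>x. (norm (f k x - u x))\<^sup>2)" for k
    using integrable_add_L2(1)[of "f k" M "\<lambda>x. - u x"] f u by simp
  have "(\<lambda>k. LINT x|M. (f k x - u x) \<bullet> h x) \<longlonglongrightarrow> 0"
  proof (rule Lim_null_comparison)
    show "eventually (\<lambda>k. norm (LINT x|M. (f k x - u x) \<bullet> h x) \<le>
       sqrt (LINT x|M. (norm (f k x - u x))\<^sup>2) * sqrt (LINT x|M. (norm (h x))\<^sup>2)) sequentially"
      using integral_Cauchy_Schwarz[OF _ _ d h] by simp
    show "(\<lambda>k. sqrt (LINT x|M. (norm (f k x - u x))\<^sup>2) * sqrt (LINT x|M. (norm (h x))\<^sup>2)) \<longlonglongrightarrow> 0"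
      using tendsto_mult_left_zero[OF tendsto_real_sqrt[OF lim, simplified]] by simp
  qed
  moreover have "(LINT x|M. (f k x - u x) \<bullet> h x) = (LINT x|M. f k x \<bullet> h x) - (LINT x|M. u x \<bullet> h x)" for k
    unfolding inner_diff_left
    using integrable_inner_L2[OF _ _ f h] integrable_inner_L2[OF _ _ u h] by simp
  ultimately show ?thesis using LIM_zero_cancel by simp
qed

text \<open>Expanding around the limit splits the weighted square into a term quadratic in
  \<open>f k - u\<close>, which vanishes since \<open>W\<close> is bounded, and a term linear in
  \<open>f k\<close>, which converges by Cauchy-Schwarz. No sign of \<open>W\<close> is
  involved.\<close>

lemma L2_tendsto_weighted_norm:
  fixes f :: "nat \<Rightarrow> 'a \<Rightarrow> 'b::euclidean_space"
  assumes meas[measurable]: "\<And>k. f k \<in> borel_measurable M" "u \<in> borel_measurable M" "W \<in> borel_measurable M"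
    and f: "\<And>k. integrable M (\<lambda>x. (norm (f k x))\<^sup>2)" and u: "integrable M (\<lambda>x. (norm (u x))\<^sup>2)"
    and W: "\<And>x. \<bar>W x\<bar> \<le> C"
    and lim: "(\<lambda>k. LINT x|M. (norm (f k x - u x))\<^sup>2) \<longlonglongrightarrow> 0"
  shows "(\<lambda>k. LINT x|M. W x * (norm (f k x))\<^sup>2) \<longlonglongrightarrow> (LINT x|M. W x * (norm (u x))\<^sup>2)"
proof -
  have Wi: "integrable M (\<lambda>x. W x * (norm (g x))\<^sup>2)"
    if "integrable M (\<lambda>x. (norm (g x))\<^sup>2)" and [measurable]: "g \<in> borel_measurable M" for g :: "'a \<Rightarrow> 'b"
    by (rule Bochner_Integration.integrable_bound[OF integrable_mult_right[OF that(1), of C]])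
       (auto simp: abs_mult intro!: mult_right_mono order_trans[OF W abs_ge_self])
  have d: "integrable M (\<lambda>x. (norm (f k x - u x))\<^sup>2)" for k
    using integrable_add_L2(1)[of "f k" M "\<lambda>x. - u x"] f u by simp
  have h: "integrable M (\<lambda>x. (norm ((2 * W x) *\<^sub>R u x))\<^sup>2)"
  proof (rule Bochner_Integration.integrable_bound[OF integrable_mult_right[OF u, of "4 * C\<^sup>2"]])
    have "(W x)\<^sup>2 \<le> C\<^sup>2" for x using W[of x] by (metis abs_ge_zero power2_abs power_mono)
    then show "AE x in M. norm ((norm ((2 * W x) *\<^sub>R u x))\<^sup>2) \<le> norm (4 * C\<^sup>2 * (norm (u x))\<^sup>2)"
      by (auto simp: power_mult_distrib intro!: mult_right_mono)
  qed simp
  have 1: "(\<lambda>k. LINT x|M. f k x \<bullet> ((2 * W x) *\<^sub>R u x)) \<longlonglongrightarrow> (LINT x|M. u x \<bullet> ((2 * W x) *\<^sub>R u x))"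
    by (rule L2_tendsto_inner[OF _ _ _ f u h lim]) simp_all
  have 2: "(\<lambda>k. LINT x|M. W x * (norm (f k x - u x))\<^sup>2) \<longlonglongrightarrow> 0"
  proof (rule Lim_null_comparison)
    have "\<bar>LINT x|M. W x * (norm (f k x - u x))\<^sup>2\<bar> \<le> (LINT x|M. C * (norm (f k x - u x))\<^sup>2)" for k
    proof (rule order_trans[OF integral_abs_bound])
      show "(LINT x|M. \<bar>W x * (norm (f k x - u x))\<^sup>2\<bar>) \<le> (LINT x|M. C * (norm (f k x - u x))\<^sup>2)"
        using d integrable_abs[OF Wi[OF d]]
        by (intro integral_mono) (auto simp: abs_mult intro!: mult_right_mono W)
    qed
    then show "eventually (\<lambda>k. norm (LINT x|M. W x * (norm (f k x - u x))\<^sup>2) \<le>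
        C * (LINT x|M. (norm (f k x - u x))\<^sup>2)) sequentially" using d by simp
    show "(\<lambda>k. C * (LINT x|M. (norm (f k x - u x))\<^sup>2)) \<longlonglongrightarrow> 0"
      using tendsto_mult_right_zero[OF lim] by simp
  qed
  have eq: "(LINT x|M. W x * (norm (f k x))\<^sup>2) =
     (LINT x|M. W x * (norm (f k x - u x))\<^sup>2) + (LINT x|M. f k x \<bullet> ((2 * W x) *\<^sub>R u x))
        - (LINT x|M. W x * (norm (u x))\<^sup>2)" for k
  proof -
    have "W x * (norm (f k x))\<^sup>2 = W x * (norm (f k x - u x))\<^sup>2 + f k x \<bullet> ((2 * W x) *\<^sub>R u x)
        - W x * (norm (u x))\<^sup>2" for x
      by (simp add: power2_norm_eq_inner inner_diff_left inner_diff_right inner_commute algebra_simps)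
    then show ?thesis
      using Wi[OF d] Wi[OF u] integrable_inner_L2[OF _ _ f h] by simp
  qed
  have 3: "(LINT x|M. u x \<bullet> ((2 * W x) *\<^sub>R u x)) = 2 * (LINT x|M. W x * (norm (u x))\<^sup>2)"
    by (simp add: power2_norm_eq_inner mult.assoc)
  show ?thesis
    unfolding eq
    using tendsto_diff[OF tendsto_add[OF 2 1] tendsto_const[of "LINT x|M. W x * (norm (u x))\<^sup>2"]]
    unfolding 3 by simp
qed

section \<open>Hardy inequalities\<close>

lemma Cc1_ballE:
  assumes "Cc1_ball \<phi> d\<phi>"
  obtains K where "\<And>x. (\<phi> has_derivative (\<lambda>h. d\<phi> x \<bullet> h)) (at x)" "continuous_on UNIV d\<phi>"
    "continuous_on UNIV \<phi>" "compact K" "K \<subseteq> ball 0 1" "\<And>x. x \<notin> K \<Longrightarrow> \<phi> x = 0" "\<And>x. x \<notin> K \<Longrightarrow> d\<phi> x = 0"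
proof -
  obtain K where der: "\<And>x. (\<phi> has_derivative (\<lambda>h. d\<phi> x \<bullet> h)) (at x)" "continuous_on UNIV d\<phi>"
    and K: "compact K" "K \<subseteq> ball 0 1" "\<And>x. x \<notin> K \<Longrightarrow> \<phi> x = 0"
    using assms unfolding Cc1_ball_def by auto
  show ?thesis
  proof (rule that[OF der _ K])
    show "continuous_on UNIV \<phi>"
      by (intro continuous_at_imp_continuous_on ballI has_derivative_continuous[OF der(1)])
    show "d\<phi> x = 0" if "x \<notin> K" for x
      using gradient_zero_outside_support[OF der(1) compact_imp_closed[OF K(1)] K(3) that] by blast
  qed
qed

lemma Cc1_ball_L2:
  assumes "Cc1_ball \<phi> d\<phi>"
  shows "\<phi> \<in> borel_measurable borel" "d\<phi> \<in> borel_measurable borel"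
    "integrable lborel (\<lambda>x. (\<phi> x)\<^sup>2)" "integrable lborel (\<lambda>x. (norm (d\<phi> x))\<^sup>2)"
proof -
  obtain K where K: "continuous_on UNIV d\<phi>"
    "continuous_on UNIV \<phi>" "compact K" "\<And>x. x \<notin> K \<Longrightarrow> \<phi> x = 0" "\<And>x. x \<notin> K \<Longrightarrow> d\<phi> x = 0"
    using Cc1_ballE[OF assms] by metis
  show "\<phi> \<in> borel_measurable borel" "d\<phi> \<in> borel_measurable borel"
    using K by (auto intro: borel_measurable_continuous_onI)
  show "integrable lborel (\<lambda>x. (\<phi> x)\<^sup>2)" "integrable lborel (\<lambda>x. (norm (d\<phi> x))\<^sup>2)"
    by (rule integrable_continuous_compact_support[OF _ K(3)]; auto intro!: continuous_intros K)+
qed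

text \<open>Radial functions are written as profiles of the squared distance, so that a
  differentiable profile gives a function differentiable at the centre too.\<close>

lemma has_derivative_radial:
  fixes c :: "'a::real_inner"
  assumes "(a has_real_derivative a') (at ((norm (x - c))\<^sup>2))"
  shows "((\<lambda>x. a ((norm (x - c))\<^sup>2)) has_derivative (\<lambda>h. ((2 * a') *\<^sub>R (x - c)) \<bullet> h)) (at x)"
proof -
  have "((\<lambda>x. (norm (x - c))\<^sup>2) has_derivative (\<lambda>h. 2 * ((x - c) \<bullet> h))) (at x)"
    unfolding power2_norm_eq_inner
    by (auto intro!: derivative_eq_intros simp: inner_commute)
  from has_derivative_compose[OF this assms[unfolded has_field_derivative_def]]
  show ?thesis by (simp add: mult_ac)
qed

text \<open>With \<open>F(x) = a(|x|\<^sup>2) x\<close>, integrate \<open>|\<nabla>\<phi> + \<phi>F|\<^sup>2 \<ge> 0\<close> and move the derivative in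
  \<open>2\<phi>\<nabla>\<phi>\<cdot>F\<close> onto \<open>F\<close>; the upper bound on \<open>W\<close> below is \<open>div F - |F|\<^sup>2\<close>.\<close>

lemma Hardy_Cc1_ball:
  fixes \<phi> :: "real^'n \<Rightarrow> real"
  assumes \<phi>: "Cc1_ball \<phi> d\<phi>"
    and a: "\<And>t. 0 \<le> t \<Longrightarrow> t < 1 \<Longrightarrow> (a has_real_derivative a' t) (at t)"
    and a': "continuous_on {0..<1} a'"
    and W: "W \<in> borel_measurable borel" "\<And>x. \<bar>W x\<bar> \<le> C"
      "\<And>x. norm x < 1 \<Longrightarrow> W x \<le> real CARD('n) * a ((norm x)\<^sup>2) + 2 * (norm x)\<^sup>2 * a' ((norm x)\<^sup>2)
           - (norm x)\<^sup>2 * (a ((norm x)\<^sup>2))\<^sup>2"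
  shows "(LINT x|lborel. W x * (\<phi> x)\<^sup>2) \<le> (LINT x|lborel. (norm (d\<phi> x))\<^sup>2)"
proof -
  note [measurable] = W(1) Cc1_ball_L2(1,2)[OF \<phi>]
  obtain K where der: "\<And>x. (\<phi> has_derivative (\<lambda>h. d\<phi> x \<bullet> h)) (at x)" and cd: "continuous_on UNIV d\<phi>"
    and c\<phi>: "continuous_on UNIV \<phi>" and K: "compact K" "K \<subseteq> ball 0 1"
      "\<And>x. x \<notin> K \<Longrightarrow> \<phi> x = 0" "\<And>x. x \<notin> K \<Longrightarrow> d\<phi> x = 0"
    using Cc1_ballE[OF \<phi>] by metis
  let ?t = "\<lambda>x::real^'n. (norm x)\<^sup>2"
  have t: "0 \<le> ?t x" "?t x < 1" if "x \<in> ball 0 1" for x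
    using that by (auto simp: power_less_one_iff abs_square_less_1)
  have ca: "continuous_on {0..<1} a"
    by (intro continuous_at_imp_continuous_on ballI DERIV_isCont) (use a in auto)
  have cat: "continuous_on (ball 0 1) (\<lambda>x. a (?t x))" "continuous_on (ball 0 1) (\<lambda>x. a' (?t x))"
    by (rule continuous_on_compose2[OF ca] continuous_on_compose2[OF a'];
        use t in \<open>auto intro!: continuous_intros\<close>)+
  define \<psi> where "\<psi> x = (\<phi> x)\<^sup>2 * a (?t x)" for x
  define d\<psi> where "d\<psi> x = (2 * \<phi> x * a (?t x)) *\<^sub>R d\<phi> x + (2 * (\<phi> x)\<^sup>2 * a' (?t x)) *\<^sub>R x" for x
  \<comment> \<open>The profile \<open>a\<close> is controlled only on \<open>{0..<1}\<close>. Since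
    \<open>\<phi>\<close> lives on the compact \<open>K\<close> inside the open ball, every product
    with it extends continuously by zero.\<close>
  have ext: "continuous_on UNIV f" if "continuous_on (ball 0 1) f" "\<And>x. x \<notin> K \<Longrightarrow> f x = 0"
    for f :: "real^'n \<Rightarrow> 'b::real_normed_vector"
    by (rule continuous_on_UNIV_zero_extension[OF compact_imp_closed[OF K(1)] _ K(2)]) (use that in auto)
  note cs = continuous_intros cat continuous_on_subset[OF cd] continuous_on_subset[OF c\<phi>]
  have int: "integrable lborel f" if "continuous_on (ball 0 1) f" "\<And>x. x \<notin> K \<Longrightarrow> f x = 0"
    for f :: "real^'n \<Rightarrow> real"
    by (rule integrable_continuous_compact_support[OF ext K(1)]) (use that in auto)
  have der\<psi>: "(\<psi> has_derivative (\<lambda>h. d\<psi> x \<bullet> h)) (at x)" for x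
  proof (cases "x \<in> ball 0 1")
    case True
    have "((\<lambda>x. a (?t x)) has_derivative (\<lambda>h. ((2 * a' (?t x)) *\<^sub>R x) \<bullet> h)) (at x)"
      using has_derivative_radial[of a "a' (?t x)" x 0] a t True by simp
    then show ?thesis unfolding \<psi>_def d\<psi>_def
      by (auto intro!: derivative_eq_intros der simp: inner_add_left algebra_simps)
  next
    case False
    then have x: "x \<in> - K" using K(2) by auto
    have "(\<psi> has_derivative (\<lambda>h. 0)) (at x)"
      by (rule has_derivative_transform_within_open[of "\<lambda>_. 0" _ _ _ "- K"])
         (use x K(1) compact_imp_closed in \<open>auto simp: \<psi>_def K(3)\<close>)
    moreover have "d\<psi> x = 0" using x K(3) by (simp add: d\<psi>_def)
    ultimately show ?thesis by simp
  qed
  have eq: "(LINT x|lborel. d\<psi> x \<bullet> (x - 0)) = - real DIM(real^'n) * (LINT x|lborel. \<psi> x)"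
  proof (rule integral_radial_derivative[OF der\<psi> _ K(1)])
    show "continuous_on UNIV d\<psi>"
      unfolding d\<psi>_def by (rule ext) (auto intro!: cs simp: K)
  qed (simp add: \<psi>_def K)
  have i1: "integrable lborel \<psi>" unfolding \<psi>_def by (rule int) (auto intro!: cs simp: K)
  have i2: "integrable lborel (\<lambda>x. 2 * \<phi> x * a (?t x) * (d\<phi> x \<bullet> x))"
    by (rule int) (auto intro!: cs simp: K)
  have i3: "integrable lborel (\<lambda>x. 2 * (\<phi> x)\<^sup>2 * a' (?t x) * ?t x)"
    by (rule int) (auto intro!: cs simp: K)
  have i4: "integrable lborel (\<lambda>x. (\<phi> x)\<^sup>2 * (a (?t x))\<^sup>2 * ?t x)"
    by (rule int) (auto intro!: cs simp: K)
  have i5: "integrable lborel (\<lambda>x. (norm (d\<phi> x))\<^sup>2)" by (rule Cc1_ball_L2(4)[OF \<phi>])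
  have i6: "integrable lborel (\<lambda>x. W x * (\<phi> x)\<^sup>2)"
    by (rule Bochner_Integration.integrable_bound[OF integrable_mult_right[OF Cc1_ball_L2(3)[OF \<phi>], of C]])
       (auto simp: abs_mult intro!: mult_right_mono order_trans[OF W(2) abs_ge_self])
  have "d\<psi> x \<bullet> (x - 0) = 2 * \<phi> x * a (?t x) * (d\<phi> x \<bullet> x) + 2 * (\<phi> x)\<^sup>2 * a' (?t x) * ?t x" for x
    by (simp add: d\<psi>_def inner_add_left power2_norm_eq_inner)
  then have eq2: "(LINT x|lborel. 2 * \<phi> x * a (?t x) * (d\<phi> x \<bullet> x)) =
      - real CARD('n) * (LINT x|lborel. \<psi> x) - (LINT x|lborel. 2 * (\<phi> x)\<^sup>2 * a' (?t x) * ?t x)"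
    using eq i2 i3 by simp
  have "W x * (\<phi> x)\<^sup>2 \<le> real CARD('n) * \<psi> x + 2 * (\<phi> x)\<^sup>2 * a' (?t x) * ?t x
          - (\<phi> x)\<^sup>2 * (a (?t x))\<^sup>2 * ?t x" for x
  proof (cases "norm x < 1")
    case True
    from mult_right_mono[OF W(3)[OF this], of "(\<phi> x)\<^sup>2"] show ?thesis
      by (simp add: \<psi>_def algebra_simps)
  next
    case False
    then have "x \<notin> K" using K(2) by auto
    then show ?thesis using K(3) by (simp add: \<psi>_def)
  qed
  then have 1: "(LINT x|lborel. W x * (\<phi> x)\<^sup>2) \<le> (LINT x|lborel. real CARD('n) * \<psi> x
      + 2 * (\<phi> x)\<^sup>2 * a' (?t x) * ?t x - (\<phi> x)\<^sup>2 * (a (?t x))\<^sup>2 * ?t x)"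
    using i1 i3 i4 i6 by (intro integral_mono) auto
  have "0 \<le> (norm (d\<phi> x + (\<phi> x * a (?t x)) *\<^sub>R x))\<^sup>2" for x by simp
  also have "(norm (d\<phi> x + (\<phi> x * a (?t x)) *\<^sub>R x))\<^sup>2 =
      (norm (d\<phi> x))\<^sup>2 + 2 * \<phi> x * a (?t x) * (d\<phi> x \<bullet> x) + (\<phi> x)\<^sup>2 * (a (?t x))\<^sup>2 * ?t x" for x
    unfolding power2_norm_eq_inner[of "d\<phi> x + _"] power2_norm_eq_inner[of x]
      power2_norm_eq_inner[of "d\<phi> x"]
    by (simp add: inner_add_left inner_add_right inner_commute algebra_simps power2_eq_square)
  finally have "0 \<le> (LINT x|lborel. (norm (d\<phi> x))\<^sup>2 + 2 * \<phi> x * a (?t x) * (d\<phi> x \<bullet> x)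
       + (\<phi> x)\<^sup>2 * (a (?t x))\<^sup>2 * ?t x)"
    by (intro Bochner_Integration.integral_nonneg) auto
  then show ?thesis using 1 i1 i2 i3 i4 i5 eq2 by simp
qed

text \<open>Density: the right side passes to the limit because the gradients converge in L2, the
  left because \<open>W\<close> is bounded. This boundedness is why the singular Hardy weights carry
  a regularisation \<open>e\<close> below.\<close>

lemma Hardy_H10:
  fixes u :: "real^'n \<Rightarrow> real"
  assumes u: "H10 u g"
    and a: "\<And>t. 0 \<le> t \<Longrightarrow> t < 1 \<Longrightarrow> (a has_real_derivative a' t) (at t)"
    and a': "continuous_on {0..<1} a'"
    and W: "W \<in> borel_measurable borel" "\<And>x. \<bar>W x\<bar> \<le> C"
      "\<And>x. norm x < 1 \<Longrightarrow> W x \<le> real CARD('n) * a ((norm x)\<^sup>2) + 2 * (norm x)\<^sup>2 * a' ((norm x)\<^sup>2)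
           - (norm x)\<^sup>2 * (a ((norm x)\<^sup>2))\<^sup>2"
  shows "(LINT x|lborel. W x * (u x)\<^sup>2) \<le> dirichlet g"
proof -
  obtain \<phi> d\<phi> where \<phi>: "\<And>k. Cc1_ball (\<phi> k) (d\<phi> k)"
    and l1: "(\<lambda>k. LINT x|lborel. (\<phi> k x - u x)\<^sup>2) \<longlonglongrightarrow> 0"
    and l2: "(\<lambda>k. LINT x|lborel. (norm (d\<phi> k x - g x))\<^sup>2) \<longlonglongrightarrow> 0"
    using u unfolding H10_def by auto
  have u': "u \<in> borel_measurable lborel" "integrable lborel (\<lambda>x. (u x)\<^sup>2)"
    "g \<in> borel_measurable lborel" "integrable lborel (\<lambda>x. (norm (g x))\<^sup>2)"
    using u unfolding H10_def by auto
  have 1: "(\<lambda>k. LINT x|lborel. W x * (norm (\<phi> k x))\<^sup>2) \<longlonglongrightarrow> (LINT x|lborel. W x * (norm (u x))\<^sup>2)"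
    by (rule L2_tendsto_weighted_norm[where C=C]) (use u' Cc1_ball_L2[OF \<phi>] W l1 in simp_all)
  have 2: "(\<lambda>k. LINT x|lborel. 1 * (norm (d\<phi> k x))\<^sup>2) \<longlonglongrightarrow> (LINT x|lborel. 1 * (norm (g x))\<^sup>2)"
    by (rule L2_tendsto_weighted_norm[where C=1]) (use u' Cc1_ball_L2[OF \<phi>] l2 in simp_all)
  show ?thesis
    using LIMSEQ_le[OF 1 2] Hardy_Cc1_ball[OF \<phi> a a' W] by (auto simp: dirichlet_def)
qed

text \<open>The field is the regularisation of the classical (N-2)/2 * x/|x|^2, whose constant
  (N-2)^2/4 is at least 1/4 in dimension three and above. The bound does not deteriorate as
  \<open>e\<close> tends to zero.\<close>

lemma Hardy_origin_H10:
  fixes u :: "real^'n \<Rightarrow> real"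
  assumes u: "H10 u g" and N: "CARD('n) \<ge> 3" and e: "e > 0"
  shows "(LINT x|lborel. (1 / 4 / (e + (norm x)\<^sup>2)) * (u x)\<^sup>2) \<le> dirichlet g"
proof -
  define k where "k = (real CARD('n) - 2) / 2"
  have k: "k \<ge> 1 / 2" "real CARD('n) = 2 * k + 2" using N by (simp_all add: k_def field_simps)
  show ?thesis
  proof (rule Hardy_H10[OF u, where a="\<lambda>t. k / (e + t)" and a'="\<lambda>t. - k / (e + t)\<^sup>2" and C="1 / 4 / e"])
    fix t :: real assume "0 \<le> t"
    then show "((\<lambda>t. k / (e + t)) has_real_derivative - k / (e + t)\<^sup>2) (at t)"
      using e by (auto intro!: derivative_eq_intros simp: power2_eq_square)
  next
    fix x :: "real^'n"
    define t where "t = (norm x)\<^sup>2"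
    have t: "t \<ge> 0" by (simp add: t_def)
    have D: "e + t > 0" using e t by simp
    have "\<bar>1 / 4 / (e + t)\<bar> = 1 / 4 / (e + t)" using D by simp
    also have "\<dots> \<le> 1 / 4 / e" using e t by (intro divide_left_mono) auto
    finally show "\<bar>1 / 4 / (e + (norm x)\<^sup>2)\<bar> \<le> 1 / 4 / e" unfolding t_def .
    have "1 / 4 * (e + t) \<le> k * k * (e + t)"
      using mult_mono[OF k(1) k(1)] D k(1) by (intro mult_right_mono) auto
    also have "\<dots> \<le> k * k * (e + t) + k * k * e + 2 * k * e"
      using k(1) e by simp
    finally have "1 / 4 * (e + t) / (e + t)\<^sup>2 \<le> (k * k * (e + t) + k * k * e + 2 * k * e) / (e + t)\<^sup>2"
      by (intro divide_right_mono) auto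
    also have "\<dots> = (2 * k + 2) * (k / (e + t)) + 2 * t * (- k / (e + t)\<^sup>2) - t * (k / (e + t))\<^sup>2"
    proof -
      have "(k * k * D + k * k * e + 2 * k * e) / D\<^sup>2 =
          (2 * k + 2) * (k / D) + 2 * (D - e) * (- k / D\<^sup>2) - (D - e) * (k / D)\<^sup>2" if "D \<noteq> 0" for D
        using that by (simp add: field_simps power2_eq_square)
      from this[of "e + t"] show ?thesis using D by simp
    qed
    finally have "1 / 4 / (e + t) \<le> (2 * k + 2) * (k / (e + t)) + 2 * t * (- k / (e + t)\<^sup>2) - t * (k / (e + t))\<^sup>2"
      using D by (simp add: power2_eq_square)
    then show "1 / 4 / (e + (norm x)\<^sup>2) \<le> real CARD('n) * (k / (e + (norm x)\<^sup>2)) + 2 * (norm x)\<^sup>2 * (- k / (e + (norm x)\<^sup>2)\<^sup>2)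
           - (norm x)\<^sup>2 * (k / (e + (norm x)\<^sup>2))\<^sup>2"
      unfolding k(2) t_def .
  qed (use e in \<open>auto intro!: continuous_intros simp: add_nonneg_eq_0_iff\<close>)
qed

text \<open>Here the field is a regularisation of x/(1 - |x|^2). As 1 - |x|^2 is at most twice the
  distance to the sphere, the limiting weight dominates the classical 1/(4 dist^2). The
  \<open>min\<close> keeps the weight bounded outside the ball, where \<open>u\<close>
  vanishes.\<close>

lemma Hardy_boundary_H10:
  fixes u :: "real^'n \<Rightarrow> real"
  assumes u: "H10 u g" and e: "e > 0"
  shows "(LINT x|lborel. (1 / (e + 1 - min 1 ((norm x)\<^sup>2))\<^sup>2) * (u x)\<^sup>2) \<le> dirichlet g"
proof (rule Hardy_H10[OF u, where a="\<lambda>t. 1 / (e + 1 - t)" and a'="\<lambda>t. 1 / (e + 1 - t)\<^sup>2" and C="1 / e\<^sup>2"])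
  fix t :: real assume "t < 1"
  then show "((\<lambda>t. 1 / (e + 1 - t)) has_real_derivative 1 / (e + 1 - t)\<^sup>2) (at t)"
    using e by (auto intro!: derivative_eq_intros simp: power2_eq_square)
next
  fix x :: "real^'n"
  have "e\<^sup>2 \<le> (e + 1 - min 1 ((norm x)\<^sup>2))\<^sup>2" using e by (intro power_mono) auto
  then show "\<bar>1 / (e + 1 - min 1 ((norm x)\<^sup>2))\<^sup>2\<bar> \<le> 1 / e\<^sup>2" using e by (simp add: frac_le)
next
  fix x :: "real^'n" assume x: "norm x < 1"
  define t where "t = (norm x)\<^sup>2"
  have t: "t \<ge> 0" "t < 1" using x by (auto simp: t_def power_less_one_iff abs_square_less_1)
  have D: "e + 1 - t > 0" using e t by simp
  have "1 * (e + 1 - t) \<le> real CARD('n) * (e + 1 - t)"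
    using D by (intro mult_right_mono) (auto simp: Suc_le_eq)
  moreover have "1 \<le> 1 * (e + 1 - t) + t" using e by simp
  ultimately have "1 \<le> real CARD('n) * (e + 1 - t) + t" by (meson add_right_mono order_trans)
  then have "1 / (e + 1 - t)\<^sup>2 \<le> (real CARD('n) * (e + 1 - t) + t) / (e + 1 - t)\<^sup>2"
    by (intro divide_right_mono) auto
  also have "\<dots> = real CARD('n) * (1 / (e + 1 - t)) + 2 * t * (1 / (e + 1 - t)\<^sup>2) - t * (1 / (e + 1 - t))\<^sup>2"
  proof -
    have "(c * D + (e + 1 - D)) / D\<^sup>2 = c * (1 / D) + 2 * (e + 1 - D) * (1 / D\<^sup>2) - (e + 1 - D) * (1 / D)\<^sup>2"
      if "D \<noteq> 0" for c D
      using that by (simp add: field_simps power2_eq_square)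
    from this[of "e + 1 - t" "real CARD('n)"] show ?thesis using D by simp
  qed
  finally show "1 / (e + 1 - min 1 ((norm x)\<^sup>2))\<^sup>2 \<le> real CARD('n) * (1 / (e + 1 - (norm x)\<^sup>2)) +
       2 * (norm x)\<^sup>2 * (1 / (e + 1 - (norm x)\<^sup>2)\<^sup>2) - (norm x)\<^sup>2 * (1 / (e + 1 - (norm x)\<^sup>2))\<^sup>2"
    using t unfolding t_def by (simp add: min_def)
qed (use e in \<open>auto intro!: continuous_intros\<close>)

text \<open>For \<open>e = 1\<close> the boundary Hardy weight lies between 1/4 and 1, so the
  boundary inequality is already a Poincare inequality.\<close>

lemma Poincare_H10:
  fixes u :: "real^'n \<Rightarrow> real"
  assumes u: "H10 u g"
  shows "(LINT x|lborel. (u x)\<^sup>2) \<le> 4 * dirichlet g"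
proof -
  have u': "u \<in> borel_measurable borel" "integrable lborel (\<lambda>x. (u x)\<^sup>2)"
    using u unfolding H10_def by auto
  note [measurable] = u'(1)
  have b: "1 / 4 \<le> 1 / (1 + 1 - min 1 ((norm x)\<^sup>2))\<^sup>2" "1 / (1 + 1 - min 1 ((norm x)\<^sup>2))\<^sup>2 \<le> 1"
    for x :: "real^'n"
  proof -
    have "(2 - min 1 ((norm x)\<^sup>2))\<^sup>2 \<le> 2\<^sup>2" "1\<^sup>2 \<le> (2 - min 1 ((norm x)\<^sup>2))\<^sup>2"
      by (intro power_mono; simp)+
    then show "1 / 4 \<le> 1 / (1 + 1 - min 1 ((norm x)\<^sup>2))\<^sup>2" "1 / (1 + 1 - min 1 ((norm x)\<^sup>2))\<^sup>2 \<le> 1"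
      by (auto simp: field_simps)
  qed
  have i: "integrable lborel (\<lambda>x. (1 / (1 + 1 - min 1 ((norm x)\<^sup>2))\<^sup>2) * (u x)\<^sup>2)"
  proof (rule Bochner_Integration.integrable_bound[OF u'(2)])
    have "(1 / (1 + 1 - min 1 ((norm x)\<^sup>2))\<^sup>2) * (u x)\<^sup>2 \<le> (u x)\<^sup>2" for x
      using b(2)[of x] by (intro mult_left_le_one_le) auto
    then show "AE x in lborel. norm ((1 / (1 + 1 - min 1 ((norm x)\<^sup>2))\<^sup>2) * (u x)\<^sup>2) \<le> norm ((u x)\<^sup>2)"
      by simp
  qed simp
  have "(LINT x|lborel. 1 / 4 * (u x)\<^sup>2) \<le>
      (LINT x|lborel. (1 / (1 + 1 - min 1 ((norm x)\<^sup>2))\<^sup>2) * (u x)\<^sup>2)"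
    by (rule integral_mono[OF _ i mult_right_mono[OF b(1)]]) (use u' in auto)
  also have "\<dots> \<le> dirichlet g" by (rule Hardy_boundary_H10[OF u]) simp
  finally show ?thesis by simp
qed

section \<open>Decay of the weight and the weighted Poincare inequality\<close>

lemma Vw_nonneg: "0 \<le> Vw R \<alpha> r"
  by (simp add: Vw_def)

text \<open>On both branches the slope, \<open>1 / R\<close> or \<open>1 / (1 - R)\<close>, exceeds
  1 in size, so the base of the power is at most 1 minus the distance to the origin or to the
  sphere, and 1 - y \<le> exp (- y). The bound no longer contains \<open>R\<close> except to select
  the branch.\<close>

lemma Vw_le_exp:
  assumes R: "0 < R" "R < 1" and r: "0 \<le> r" "r \<le> 1" and \<alpha>: "\<alpha> > 0"
  shows "Vw R \<alpha> r \<le> exp (- \<alpha> * (if r < R then r else 1 - r))"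
proof (cases "r < R")
  case True
  have "1 - r / R \<le> 1 - r"
    using R r mult_left_le_one_le[of r R] by (simp add: field_simps)
  also have "1 - r \<le> exp (- r)" using exp_ge_add_one_self[of "- r"] by simp
  finally have "(1 - r / R) powr \<alpha> \<le> exp (- r) powr \<alpha>"
    using True R \<alpha> by (intro powr_mono2) (auto simp: field_simps)
  then show ?thesis using True by (simp add: Vw_def exp_powr_real mult.commute)
next
  case False
  have "(1 - r) \<le> (1 - r) / (1 - R)"
    using R r mult_left_le_one_le[of "1 - r" "1 - R"] by (simp add: field_simps)
  then have "1 - (1 - r) / (1 - R) \<le> 1 - (1 - r)" by simp
  also have "\<dots> \<le> exp (- (1 - r))" using exp_ge_add_one_self[of "- (1 - r)"] by simp
  finally have "(1 - (1 - r) / (1 - R)) powr \<alpha> \<le> exp (- (1 - r)) powr \<alpha>"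
    using False R \<alpha> by (intro powr_mono2) (auto simp: field_simps)
  then show ?thesis using False by (simp add: Vw_def exp_powr_real algebra_simps)
qed

lemma Vw_le_1:
  assumes "0 < R" "R < 1" "0 \<le> r" "r \<le> 1" "\<alpha> > 0"
  shows "Vw R \<alpha> r \<le> 1"
  by (rule order_trans[OF Vw_le_exp[OF assms]]) (use assms in auto)

lemma Vw_measurable [measurable]: "Vw R \<alpha> \<in> borel_measurable borel"
  unfolding Vw_def[abs_def] by measurable

text \<open>The scaled forms of the two Hardy weights: \<open>t\<close> stands for \<alpha> times
  the distance to the origin in the first bound and to the sphere in the second. The factor 2 in
  \<open>1 + 2 * t\<close> comes from 1 - r^2 \<le> 2 (1 - r).\<close>

lemma exp_neg_le_Hardy_weights:
  fixes t :: real
  assumes "t \<ge> 0"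
  shows "exp (- t) \<le> 2 / (1 + t\<^sup>2)" "exp (- t) \<le> 8 / (1 + 2 * t)\<^sup>2"
proof -
  have e: "exp t \<ge> 1 + t + t\<^sup>2 / 2" using exp_lower_Taylor_quadratic[OF assms] .
  have "(1 + t\<^sup>2) / 2 \<le> exp t" using e assms by (simp add: field_simps)
  then have "1 / exp t \<le> 1 / ((1 + t\<^sup>2) / 2)" by (intro divide_left_mono) (auto simp: add_pos_nonneg)
  then show "exp (- t) \<le> 2 / (1 + t\<^sup>2)" by (simp add: exp_minus inverse_eq_divide)
  have "(1 + 2 * t)\<^sup>2 / 8 = 1 / 8 + t / 2 + t\<^sup>2 / 2" by (simp add: power2_eq_square field_simps)
  then have "(1 + 2 * t)\<^sup>2 / 8 \<le> exp t" using e assms by simp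
  then have "1 / exp t \<le> 1 / ((1 + 2 * t)\<^sup>2 / 8)"
    using assms by (intro divide_left_mono) auto
  then show "exp (- t) \<le> 8 / (1 + 2 * t)\<^sup>2" by (simp add: exp_minus inverse_eq_divide)
qed

text \<open>The weight lives at scale 1/\<alpha> near the origin and near the sphere, so the Hardy
  weights are regularised at exactly that scale: \<open>e\<close> is
  \<open>(1 / \<alpha>)\<^sup>2\<close> at the origin and \<open>1 / \<alpha>\<close> at the
  boundary. Scaling produces the gain \<open>1 / \<alpha>\<^sup>2\<close>.\<close>

lemma Vw_le_Hardy_weights:
  assumes R: "0 < R" "R < 1" and r: "0 \<le> r" "r \<le> 1" and \<alpha>: "\<alpha> > 0"
  shows "Vw R \<alpha> r \<le> 8 / \<alpha>\<^sup>2 * (1 / ((1 / \<alpha>)\<^sup>2 + r\<^sup>2) + 1 / (1 / \<alpha> + 1 - r\<^sup>2)\<^sup>2)"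
proof -
  have r2: "r\<^sup>2 \<le> 1" using r by (simp add: power_le_one)
  have nn: "0 \<le> 1 / ((1 / \<alpha>)\<^sup>2 + r\<^sup>2)" "0 \<le> 1 / (1 / \<alpha> + 1 - r\<^sup>2)\<^sup>2"
    using \<alpha> r2 by auto
  show ?thesis
  proof (cases "r < R")
    case True
    then have "Vw R \<alpha> r \<le> exp (- (\<alpha> * r))" using Vw_le_exp[OF assms] by simp
    also have "\<dots> \<le> 2 / (1 + (\<alpha> * r)\<^sup>2)" using exp_neg_le_Hardy_weights(1)[of "\<alpha> * r"] \<alpha> r by simp
    also have "\<dots> = 2 / \<alpha>\<^sup>2 * (1 / ((1 / \<alpha>)\<^sup>2 + r\<^sup>2))" using \<alpha> by (simp add: field_simps power2_eq_square)
    also have "\<dots> \<le> 8 / \<alpha>\<^sup>2 * (1 / ((1 / \<alpha>)\<^sup>2 + r\<^sup>2) + 1 / (1 / \<alpha> + 1 - r\<^sup>2)\<^sup>2)"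
      using nn \<alpha> by (intro mult_mono) (auto intro!: divide_right_mono)
    finally show ?thesis .
  next
    case False
    then have "Vw R \<alpha> r \<le> exp (- (\<alpha> * (1 - r)))" using Vw_le_exp[OF assms] by simp
    also have "\<dots> \<le> 8 / (1 + 2 * (\<alpha> * (1 - r)))\<^sup>2"
      using exp_neg_le_Hardy_weights(2)[of "\<alpha> * (1 - r)"] \<alpha> r by simp
    also have "1 + 2 * (\<alpha> * (1 - r)) = \<alpha> * (1 / \<alpha> + 2 * (1 - r))" using \<alpha> by (simp add: field_simps)
    also have "8 / (\<alpha> * (1 / \<alpha> + 2 * (1 - r)))\<^sup>2 = 8 / \<alpha>\<^sup>2 * (1 / (1 / \<alpha> + 2 * (1 - r))\<^sup>2)"
      by (simp add: power_mult_distrib)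
    also have "\<dots> \<le> 8 / \<alpha>\<^sup>2 * (1 / (1 / \<alpha> + 1 - r\<^sup>2)\<^sup>2)"
    proof (intro mult_left_mono divide_left_mono power_mono)
      have "0 \<le> (1 - r)\<^sup>2" by simp
      then show "1 / \<alpha> + 1 - r\<^sup>2 \<le> 1 / \<alpha> + 2 * (1 - r)" by (simp add: power2_eq_square algebra_simps)
      have "0 < 1 / \<alpha> + 1 - r\<^sup>2" using \<alpha> r2 by (simp add: add_pos_nonneg add_diff_eq[symmetric])
      then show "0 \<le> 1 / \<alpha> + 1 - r\<^sup>2" "0 < (1 / \<alpha> + 2 * (1 - r))\<^sup>2 * (1 / \<alpha> + 1 - r\<^sup>2)\<^sup>2"
        using \<alpha> r by (auto intro!: mult_pos_pos zero_less_power add_pos_nonneg)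
    qed auto
    also have "\<dots> \<le> 8 / \<alpha>\<^sup>2 * (1 / ((1 / \<alpha>)\<^sup>2 + r\<^sup>2) + 1 / (1 / \<alpha> + 1 - r\<^sup>2)\<^sup>2)"
      using nn by (intro mult_left_mono) auto
    finally show ?thesis .
  qed
qed

text \<open>The two Hardy inequalities are added. The constant is 40 = 8 * (4 + 1): the 8 bounds the
  weight, the 4 compensates the 1/4 in the origin inequality, and the boundary inequality
  contributes 1.\<close>

lemma weighted_Poincare_H10:
  fixes u :: "real^'n \<Rightarrow> real"
  assumes u: "H10 u g" and N: "CARD('n) \<ge> 3" and R: "0 < R" "R < 1" and \<alpha>: "\<alpha> > 0"
  shows "(LINT x|lborel. Vw R \<alpha> (norm x) * (u x)\<^sup>2) \<le> 40 / \<alpha>\<^sup>2 * dirichlet g"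
proof -
  have u': "u \<in> borel_measurable borel" "integrable lborel (\<lambda>x. (u x)\<^sup>2)" "\<And>x. norm x \<ge> 1 \<Longrightarrow> u x = 0"
    using u unfolding H10_def by auto
  note [measurable] = u'(1)
  define W1 where "W1 x = 1 / 4 / ((1 / \<alpha>)\<^sup>2 + (norm x)\<^sup>2)" for x :: "real^'n"
  define W2 where "W2 x = 1 / (1 / \<alpha> + 1 - min 1 ((norm x)\<^sup>2))\<^sup>2" for x :: "real^'n"
  have [measurable]: "W1 \<in> borel_measurable borel" "W2 \<in> borel_measurable borel"
    unfolding W1_def[abs_def] W2_def[abs_def] by measurable
  have h: "(LINT x|lborel. W1 x * (u x)\<^sup>2) \<le> dirichlet g" "(LINT x|lborel. W2 x * (u x)\<^sup>2) \<le> dirichlet g"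
    unfolding W1_def W2_def
    using \<alpha> by (auto intro!: Hardy_origin_H10[OF u N, of "(1 / \<alpha>)\<^sup>2", simplified]
      Hardy_boundary_H10[OF u, of "1 / \<alpha>", simplified])
  have i: "integrable lborel (\<lambda>x. W x * (u x)\<^sup>2)"
    if "\<And>x. 0 \<le> W x" "\<And>x. norm x < 1 \<Longrightarrow> W x \<le> C" "W \<in> borel_measurable borel" for C and W :: "real^'n \<Rightarrow> real"
  proof (rule Bochner_Integration.integrable_bound[OF integrable_mult_right[OF u'(2), of C]])
    have "norm (W x * (u x)\<^sup>2) \<le> norm (C * (u x)\<^sup>2)" for x
      using that(1)[of x] that(2)[of x] u'(3)[of x]
      by (cases "norm x < 1") (auto simp: abs_mult intro!: mult_right_mono)
    then show "AE x in lborel. norm (W x * (u x)\<^sup>2) \<le> norm (C * (u x)\<^sup>2)" by simp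
  qed (use that(3) in measurable)
  have i1: "integrable lborel (\<lambda>x. W1 x * (u x)\<^sup>2)"
  proof (rule i[where C="1 / 4 / (1 / \<alpha>)\<^sup>2"])
    show "W1 x \<le> 1 / 4 / (1 / \<alpha>)\<^sup>2" for x
      unfolding W1_def using \<alpha> by (intro divide_left_mono) (auto intro!: mult_pos_pos add_pos_nonneg)
  qed (auto simp: W1_def)
  have i2: "integrable lborel (\<lambda>x. W2 x * (u x)\<^sup>2)"
  proof (rule i[where C="1 / (1 / \<alpha>)\<^sup>2"])
    show "W2 x \<le> 1 / (1 / \<alpha>)\<^sup>2" for x
      unfolding W2_def using \<alpha>
      by (intro divide_left_mono power_mono mult_pos_pos zero_less_power) (auto simp: add_pos_nonneg add_diff_eq[symmetric])
  qed (auto simp: W2_def)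
  have i3: "integrable lborel (\<lambda>x. Vw R \<alpha> (norm x) * (u x)\<^sup>2)"
    by (rule i[where C=1]) (use R \<alpha> in \<open>auto simp: Vw_nonneg intro!: Vw_le_1\<close>)
  have "Vw R \<alpha> (norm x) * (u x)\<^sup>2 \<le> 8 / \<alpha>\<^sup>2 * (4 * (W1 x * (u x)\<^sup>2) + W2 x * (u x)\<^sup>2)" for x
  proof (cases "norm x < 1")
    case True
    then have "(norm x)\<^sup>2 \<le> 1" by (simp add: power_le_one)
    then have "Vw R \<alpha> (norm x) \<le> 8 / \<alpha>\<^sup>2 * (4 * W1 x + W2 x)"
    proof -
      have "4 * (1 / 4 / X) = 1 / X" for X :: real by simp
      then have "4 * W1 x = 1 / ((1 / \<alpha>)\<^sup>2 + (norm x)\<^sup>2)" unfolding W1_def .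
      moreover have "W2 x = 1 / (1 / \<alpha> + 1 - (norm x)\<^sup>2)\<^sup>2"
        using \<open>(norm x)\<^sup>2 \<le> 1\<close> unfolding W2_def by (simp add: min_absorb2)
      ultimately show ?thesis using Vw_le_Hardy_weights[OF R _ _ \<alpha>, of "norm x"] True by simp
    qed
    from mult_right_mono[OF this, of "(u x)\<^sup>2"] show ?thesis
      by (simp add: algebra_simps add_divide_distrib)
  next
    case False
    then show ?thesis using u'(3) by simp
  qed
  then have "(LINT x|lborel. Vw R \<alpha> (norm x) * (u x)\<^sup>2) \<le>
      (LINT x|lborel. 8 / \<alpha>\<^sup>2 * (4 * (W1 x * (u x)\<^sup>2) + W2 x * (u x)\<^sup>2))"
    using i1 i2 i3 by (intro integral_mono) auto
  also have "\<dots> = 8 / \<alpha>\<^sup>2 * (4 * (LINT x|lborel. W1 x * (u x)\<^sup>2) + (LINT x|lborel. W2 x * (u x)\<^sup>2))"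
    using i1 i2 by simp
  also have "\<dots> \<le> 8 / \<alpha>\<^sup>2 * (4 * dirichlet g + dirichlet g)"
    using h by (intro mult_left_mono add_mono) auto
  finally show ?thesis by simp
qed

section \<open>The Euler-Lagrange inequality\<close>

text \<open>Freezing a profile at a critical point \<open>t1\<close> keeps it differentiable: at
  \<open>t1\<close> the new difference quotient is either the old one or 0. With
  \<open>K t1 = 0\<close> this is extension by zero; applied again to \<open>K'\<close> it yields a
  second derivative.\<close>

lemma DERIV_min_glue:
  fixes K :: "real \<Rightarrow> real"
  assumes K: "(K has_real_derivative K' (min t t1)) (at (min t t1))" and z: "K' t1 = 0"
  shows "((\<lambda>t. K (min t t1)) has_real_derivative K' (min t t1)) (at t)"
proof -
  consider "t < t1" | "t > t1" | "t = t1" by linarith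
  then show ?thesis
  proof cases
    case 1
    have "(K has_real_derivative K' (min t t1)) (at t)" using K 1 by simp
    then show ?thesis
      by (rule has_field_derivative_transform_within_open[where S="{..<t1}"]) (use 1 in auto)
  next
    case 2
    have "((\<lambda>t. K t1) has_real_derivative 0) (at t)" by simp
    then have "((\<lambda>t. K (min t t1)) has_real_derivative 0) (at t)"
      by (rule has_field_derivative_transform_within_open[where S="{t1<..}"]) (use 2 in auto)
    then show ?thesis using 2 z by simp
  next
    case 3
    have "((\<lambda>h. (K (t1 + h) - K t1) / h) \<longlongrightarrow> 0) (at 0)"
      using K z 3 by (simp add: DERIV_def)
    then have "((\<lambda>h. \<bar>(K (t1 + h) - K t1) / h\<bar>) \<longlongrightarrow> 0) (at 0)" by (rule tendsto_rabs_zero)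
    moreover have "eventually (\<lambda>h. norm ((K (min (t1 + h) t1) - K t1) / h) \<le> \<bar>(K (t1 + h) - K t1) / h\<bar>) (at 0)"
      by (rule always_eventually) (auto simp: min_def)
    ultimately have "((\<lambda>h. (K (min (t1 + h) t1) - K t1) / h) \<longlongrightarrow> 0) (at 0)"
      by (rule Lim_null_comparison[rotated])
    then show ?thesis using 3 z by (simp add: DERIV_def)
  qed
qed

lemma Cc1_ball_radial:
  fixes c :: "real^'n"
  assumes H: "\<And>t. 0 \<le> t \<Longrightarrow> (H has_real_derivative H' t) (at t)"
    and H': "continuous_on {0..} H'"
    and H0: "\<And>t. d\<^sup>2 \<le> t \<Longrightarrow> H t = 0" and d: "0 < d" and c: "norm c + d < 1"
  shows "Cc1_ball (\<lambda>x. H ((norm (x - c))\<^sup>2)) (\<lambda>x. (2 * H' ((norm (x - c))\<^sup>2)) *\<^sub>R (x - c))"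
  unfolding Cc1_ball_def
proof (intro conjI allI exI[of _ "cball c d"] impI)
  show "((\<lambda>x. H ((norm (x - c))\<^sup>2)) has_derivative (\<lambda>h. ((2 * H' ((norm (x - c))\<^sup>2)) *\<^sub>R (x - c)) \<bullet> h)) (at x)" for x
    by (rule has_derivative_radial) (simp add: H)
  show "continuous_on UNIV (\<lambda>x. (2 * H' ((norm (x - c))\<^sup>2)) *\<^sub>R (x - c))"
    by (auto intro!: continuous_intros continuous_on_compose2[OF H'])
  show "cball c d \<subseteq> ball 0 1"
  proof
    fix x assume "x \<in> cball c d"
    then have "norm (x - c) \<le> d" by (simp add: dist_norm norm_minus_commute)
    then show "x \<in> ball 0 1" using c norm_triangle_ineq2[of x c] by simp
  qed
  show "H ((norm (x - c))\<^sup>2) = 0" if "x \<notin> cball c d" for x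
  proof (rule H0)
    have "d \<le> norm (x - c)" using that by (simp add: dist_norm norm_minus_commute)
    then show "d\<^sup>2 \<le> (norm (x - c))\<^sup>2" using d by (intro power_mono) auto
  qed
qed simp

lemma H10_Cc1_ball:
  assumes "Cc1_ball \<phi> d\<phi>"
  shows "H10 \<phi> d\<phi>"
proof -
  obtain K where "K \<subseteq> ball 0 1" "\<And>x. x \<notin> K \<Longrightarrow> \<phi> x = 0"
    using Cc1_ballE[OF assms] by metis
  then have "\<phi> x = 0" if "x \<notin> ball 0 1" for x using that by blast
  then show ?thesis unfolding H10_def using Cc1_ball_L2[OF assms] assms
    by (auto intro!: exI[of _ "\<lambda>_. \<phi>"] exI[of _ "\<lambda>_. d\<phi>"])
qed

text \<open>These are the variations of the Rayleigh quotient. Subtracting the same multiple of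
  \<open>\<phi>\<close> from every approximant leaves the approximation errors unchanged.\<close>

lemma H10_minus_Cc1_ball:
  assumes u: "H10 u g" and \<phi>: "Cc1_ball \<phi> d\<phi>"
  shows "H10 (\<lambda>x. u x - l * \<phi> x) (\<lambda>x. g x - l *\<^sub>R d\<phi> x)"
    and "dirichlet (\<lambda>x. g x - l *\<^sub>R d\<phi> x) =
       dirichlet g - 2 * l * (LINT x|lborel. g x \<bullet> d\<phi> x) + l\<^sup>2 * dirichlet d\<phi>"
proof -
  have u': "\<And>x. norm x \<ge> 1 \<Longrightarrow> u x = 0" "u \<in> borel_measurable borel" "integrable lborel (\<lambda>x. (u x)\<^sup>2)"
    "g \<in> borel_measurable borel" "integrable lborel (\<lambda>x. (norm (g x))\<^sup>2)"
    using u unfolding H10_def by auto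
  note \<phi>' = Cc1_ball_L2[OF \<phi>]
  note [measurable] = u'(2,4) \<phi>'(1,2)
  obtain f df where f: "\<And>k. Cc1_ball (f k) (df k)"
    and l1: "(\<lambda>k. LINT x|lborel. (f k x - u x)\<^sup>2) \<longlonglongrightarrow> 0"
    and l2: "(\<lambda>k. LINT x|lborel. (norm (df k x - g x))\<^sup>2) \<longlonglongrightarrow> 0"
    using u unfolding H10_def by auto
  obtain K where K: "compact K" "K \<subseteq> ball 0 1" "\<And>x. x \<notin> K \<Longrightarrow> \<phi> x = 0"
    using Cc1_ballE[OF \<phi>] by metis
  have Cc1: "Cc1_ball (\<lambda>x. f k x - l * \<phi> x) (\<lambda>x. df k x - l *\<^sub>R d\<phi> x)" for k
  proof -
    obtain K' where K': "compact K'" "K' \<subseteq> ball 0 1" "\<And>x. x \<notin> K' \<Longrightarrow> f k x = 0"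
      using Cc1_ballE[OF f[of k]] by metis
    show ?thesis
      unfolding Cc1_ball_def
    proof (intro conjI allI exI[of _ "K \<union> K'"] impI)
      show "((\<lambda>x. f k x - l * \<phi> x) has_derivative (\<lambda>h. (df k x - l *\<^sub>R d\<phi> x) \<bullet> h)) (at x)" for x
        using f[of k] \<phi> unfolding Cc1_ball_def
        by (auto intro!: derivative_eq_intros simp: inner_diff_left)
      show "continuous_on UNIV (\<lambda>x. df k x - l *\<^sub>R d\<phi> x)"
        using f[of k] \<phi> unfolding Cc1_ball_def by (auto intro!: continuous_intros)
    qed (use K K' in auto)
  qed
  have i1: "integrable lborel (\<lambda>x. (norm (- (l *\<^sub>R d\<phi> x)))\<^sup>2)"
    using \<phi>'(4) by (simp add: power_mult_distrib)
  have i2: "integrable lborel (\<lambda>x. (norm (- (l * \<phi> x)))\<^sup>2)"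
    using \<phi>'(3) by (simp add: power_mult_distrib)
  show "H10 (\<lambda>x. u x - l * \<phi> x) (\<lambda>x. g x - l *\<^sub>R d\<phi> x)"
    unfolding H10_def
  proof (intro conjI allI impI exI[of _ "\<lambda>k x. f k x - l * \<phi> x"] exI[of _ "\<lambda>k x. df k x - l *\<^sub>R d\<phi> x"] Cc1)
    show "u x - l * \<phi> x = 0" if "x \<notin> ball 0 1" for x
      using that u'(1)[of x] K(2) K(3)[of x] by (cases "x \<in> K") auto
    show "integrable lborel (\<lambda>x. (u x - l * \<phi> x)\<^sup>2)"
      using integrable_add_L2(1)[of u lborel "\<lambda>x. - (l * \<phi> x)"] i2 u'(3) by simp
    show "integrable lborel (\<lambda>x. (norm (g x - l *\<^sub>R d\<phi> x))\<^sup>2)"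
      using integrable_add_L2(1)[of g lborel "\<lambda>x. - (l *\<^sub>R d\<phi> x)"] i1 u'(5) by simp
  qed (use l1 l2 in simp_all)
  show "dirichlet (\<lambda>x. g x - l *\<^sub>R d\<phi> x) =
       dirichlet g - 2 * l * (LINT x|lborel. g x \<bullet> d\<phi> x) + l\<^sup>2 * dirichlet d\<phi>"
    using integrable_add_L2(2)[of g lborel "\<lambda>x. - (l *\<^sub>R d\<phi> x)"] i1 u'(5)
    by (simp add: dirichlet_def power_mult_distrib)
qed

text \<open>Green's identity against the radial function with profile \<open>H\<close>: the bracket
  on the right is its Laplacian, 4 t H'' + 2 N H' at t = |x - c|^2. It holds for the approximants by
  the divergence theorem, and both sides are L2 pairings with fixed functions, hence stable in the
  limit.\<close>

lemma H10_integral_inner_radial: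
  fixes c :: "real^'n"
  assumes u: "H10 u g"
    and H: "\<And>t. 0 \<le> t \<Longrightarrow> (H has_real_derivative H' t) (at t)"
    and H1: "\<And>t. 0 \<le> t \<Longrightarrow> (H' has_real_derivative H'' t) (at t)"
    and H2: "continuous_on {0..} H''"
    and H0: "\<And>t. d\<^sup>2 \<le> t \<Longrightarrow> H t = 0" and d: "0 < d" and c: "norm c + d < 1"
  shows "(LINT x|lborel. g x \<bullet> ((2 * H' ((norm (x - c))\<^sup>2)) *\<^sub>R (x - c))) =
    - (LINT x|lborel. u x * (4 * (norm (x - c))\<^sup>2 * H'' ((norm (x - c))\<^sup>2)
                              + 2 * real CARD('n) * H' ((norm (x - c))\<^sup>2)))"
proof -
  let ?t = "\<lambda>x::real^'n. (norm (x - c))\<^sup>2"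
  have H1c: "continuous_on {0..} H'"
    by (intro continuous_at_imp_continuous_on ballI DERIV_isCont) (use H1 in auto)
  have H1z: "H' t = 0" if "d\<^sup>2 < t" for t
  proof -
    have "((\<lambda>_. 0) has_real_derivative 0) (at t)" by simp
    then have "(H has_real_derivative 0) (at t)"
      by (rule has_field_derivative_transform_within_open[where S="{d\<^sup>2<..}"]) (use that H0 in auto)
    moreover have "0 \<le> t" using that zero_le_power2[of d] by linarith
    ultimately show ?thesis using H DERIV_unique by blast
  qed
  have H2z: "H'' t = 0" if "d\<^sup>2 < t" for t
  proof -
    have "((\<lambda>_. 0) has_real_derivative 0) (at t)" by simp
    then have "(H' has_real_derivative 0) (at t)"
      by (rule has_field_derivative_transform_within_open[where S="{d\<^sup>2<..}"]) (use that H1z in auto)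
    moreover have "0 \<le> t" using that zero_le_power2[of d] by linarith
    ultimately show ?thesis using H1 DERIV_unique by blast
  qed
  have far: "d\<^sup>2 < ?t x" if "x \<notin> cball c d" for x
    using that d by (auto simp: dist_norm norm_minus_commute intro!: power_strict_mono)
  have c1: "continuous_on UNIV (\<lambda>x. H' (?t x))" "continuous_on UNIV (\<lambda>x. H'' (?t x))"
    by (auto intro!: continuous_intros continuous_on_compose2[OF H1c] continuous_on_compose2[OF H2])
  have u': "u \<in> borel_measurable lborel" "integrable lborel (\<lambda>x. (u x)\<^sup>2)"
    "g \<in> borel_measurable lborel" "integrable lborel (\<lambda>x. (norm (g x))\<^sup>2)"
    using u unfolding H10_def by auto
  obtain f df where f: "\<And>k. Cc1_ball (f k) (df k)"
    and l1: "(\<lambda>k. LINT x|lborel. (f k x - u x)\<^sup>2) \<longlonglongrightarrow> 0"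
    and l2: "(\<lambda>k. LINT x|lborel. (norm (df k x - g x))\<^sup>2) \<longlonglongrightarrow> 0"
    using u unfolding H10_def by auto
  define v where "v x = (2 * H' (?t x)) *\<^sub>R (x - c)" for x
  define w where "w x = 4 * ?t x * H'' (?t x) + 2 * real CARD('n) * H' (?t x)" for x
  have vw: "continuous_on UNIV v" "continuous_on UNIV w" "\<And>x. x \<notin> cball c d \<Longrightarrow> v x = 0"
     "\<And>x. x \<notin> cball c d \<Longrightarrow> w x = 0"
    unfolding v_def w_def using far by (auto intro!: continuous_intros c1 simp: H1z H2z)
  have [measurable]: "v \<in> borel_measurable borel" "w \<in> borel_measurable borel"
    using vw borel_measurable_continuous_onI by auto
  have iv: "integrable lborel (\<lambda>x. (norm (v x))\<^sup>2)" "integrable lborel (\<lambda>x. (norm (w x))\<^sup>2)"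
    by (rule integrable_continuous_compact_support[OF _ compact_cball[of c d]];
        auto intro!: continuous_intros vw(1,2) simp: vw(3,4))+
  have a1: "(\<lambda>k. LINT x|lborel. df k x \<bullet> v x) \<longlonglongrightarrow> (LINT x|lborel. g x \<bullet> v x)"
    by (rule L2_tendsto_inner) (use iv u' Cc1_ball_L2[OF f] l2 in simp_all)
  have a2: "(\<lambda>k. LINT x|lborel. f k x \<bullet> w x) \<longlonglongrightarrow> (LINT x|lborel. u x \<bullet> w x)"
    by (rule L2_tendsto_inner) (use iv u' Cc1_ball_L2[OF f] l1 in simp_all)
  have eq: "(LINT x|lborel. df k x \<bullet> v x) = - (LINT x|lborel. f k x \<bullet> w x)" for k
  proof -
    obtain K where der: "\<And>x. (f k has_derivative (\<lambda>h. df k x \<bullet> h)) (at x)"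
      and cd: "continuous_on UNIV (df k)" "continuous_on UNIV (f k)"
      and K: "compact K" "\<And>x. x \<notin> K \<Longrightarrow> f k x = 0" "\<And>x. x \<notin> K \<Longrightarrow> df k x = 0"
      using Cc1_ballE[OF f[of k]] by metis
    \<comment> \<open>The field \<open>f k x *\<^sub>R v x\<close> equals
      \<open>\<psi> x *\<^sub>R (x - c)\<close>, so the divergence theorem for radial fields applies
      to it.\<close>
    define \<psi> where "\<psi> x = f k x * (2 * H' (?t x))" for x
    define d\<psi> where "d\<psi> x = (2 * H' (?t x)) *\<^sub>R df k x + (4 * f k x * H'' (?t x)) *\<^sub>R (x - c)" for x
    have 1: "(LINT x|lborel. d\<psi> x \<bullet> (x - c)) = - real DIM(real^'n) * (LINT x|lborel. \<psi> x)"
    proof (rule integral_radial_derivative[OF _ _ K(1)])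
      fix x
      have "((\<lambda>x. H' (?t x)) has_derivative (\<lambda>h. ((2 * H'' (?t x)) *\<^sub>R (x - c)) \<bullet> h)) (at x)"
        by (rule has_derivative_radial) (simp add: H1)
      then show "(\<psi> has_derivative (\<lambda>h. d\<psi> x \<bullet> h)) (at x)" unfolding \<psi>_def d\<psi>_def
        by (auto intro!: derivative_eq_intros der simp: inner_add_left algebra_simps)
    qed (auto simp: \<psi>_def d\<psi>_def K intro!: continuous_intros c1 cd)
    have i1: "integrable lborel \<psi>" "integrable lborel (\<lambda>x. df k x \<bullet> v x)"
       "integrable lborel (\<lambda>x. f k x * (4 * ?t x * H'' (?t x)))"
      unfolding \<psi>_def
      by (rule integrable_continuous_compact_support[OF _ K(1)]; auto intro!: continuous_intros c1 cd vw simp: K)+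
    have "d\<psi> x \<bullet> (x - c) = df k x \<bullet> v x + f k x * (4 * ?t x * H'' (?t x))" for x
      by (simp add: d\<psi>_def v_def inner_add_left power2_norm_eq_inner)
    then have 2: "(LINT x|lborel. df k x \<bullet> v x) + (LINT x|lborel. f k x * (4 * ?t x * H'' (?t x))) =
       - real CARD('n) * (LINT x|lborel. \<psi> x)" using 1 i1 by simp
    have "f k x \<bullet> w x = f k x * (4 * ?t x * H'' (?t x)) + real CARD('n) * \<psi> x" for x
      by (simp add: w_def \<psi>_def algebra_simps)
    then have "(LINT x|lborel. f k x \<bullet> w x) =
        (LINT x|lborel. f k x * (4 * ?t x * H'' (?t x))) + real CARD('n) * (LINT x|lborel. \<psi> x)"
      using i1 by simp
    with 2 show ?thesis by simp
  qed
  have "(LINT x|lborel. g x \<bullet> v x) = - (LINT x|lborel. u x \<bullet> w x)"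
    using LIMSEQ_unique[OF a1[unfolded eq] tendsto_minus[OF a2]] .
  then show ?thesis by (simp add: v_def w_def)
qed

text \<open>The convex function |.|^q lies above its tangent at \<open>a\<close>. Young's inequality
  gives this for both signs of \<open>a - y\<close> at once. It bounds the constraint integral of a
  variation from below by an affine function of the step.\<close>

lemma powr_tangent_le:
  fixes a y q :: real
  assumes "a \<ge> 0" "q > 1"
  shows "a powr q - q * y * a powr (q - 1) \<le> \<bar>a - y\<bar> powr q"
proof -
  define b where "b = \<bar>a - y\<bar>"
  have "a powr (q - 1) * b \<le> (a powr (q - 1)) powr (q / (q - 1)) / (q / (q - 1)) + b powr q / q"
    by (rule Youngs_inequality) (use assms in \<open>auto simp: b_def field_simps\<close>)
  also have "(a powr (q - 1)) powr (q / (q - 1)) = a powr q" using assms by (simp add: powr_powr)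
  finally have "q * (a powr (q - 1) * b) \<le> q * (a powr q / (q / (q - 1)) + b powr q / q)"
    using assms by (intro mult_left_mono) auto
  also have "\<dots> = (q - 1) * a powr q + b powr q" using assms by (simp add: field_simps)
  finally have 1: "q * (a powr (q - 1) * b) \<le> (q - 1) * a powr q + b powr q" .
  have "q * (a powr (q - 1) * (a - y)) \<le> q * (a powr (q - 1) * b)"
    using assms by (intro mult_left_mono) (auto simp: b_def)
  moreover have "a powr (q - 1) * a = a powr q" using assms powr_mult_base[of a "q - 1"]
    by (simp add: mult.commute)
  moreover have "q * (a powr (q - 1) * (a - y)) = q * (a powr (q - 1) * a) - q * y * a powr (q - 1)"
    by (simp add: algebra_simps)
  moreover have "(q - 1) * a powr q = q * a powr q - a powr q" by (simp add: algebra_simps)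
  ultimately have "a powr q - q * y * a powr (q - 1) \<le> b powr q" using 1 by simp
  then show ?thesis by (simp add: b_def)
qed

lemma integrable_bounded_on_ball:
  fixes f :: "real^'n \<Rightarrow> real"
  assumes [measurable]: "f \<in> borel_measurable borel" and "\<And>x. norm x < 1 \<Longrightarrow> \<bar>f x\<bar> \<le> C" "\<And>x. norm x \<ge> 1 \<Longrightarrow> f x = 0"
  shows "integrable lborel f"
proof (rule Bochner_Integration.integrable_bound)
  show "integrable lborel (\<lambda>x. indicator (cball 0 1) x *\<^sub>R C)"
    by (rule borel_integrable_compact) auto
  have "norm (f x) \<le> norm (indicator (cball 0 1) x *\<^sub>R C)" for x
    using assms(2)[of x] assms(3)[of x] by (cases "norm x < 1") auto
  then show "AE x in lborel. norm (f x) \<le> norm (indicator (cball 0 1) x *\<^sub>R C)" by simp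
qed simp

lemma S_const_le_rayleigh:
  fixes u :: "real^'n \<Rightarrow> real"
  assumes "H10 u g" "\<not> (AE x in lborel. u x = 0)"
  shows "S_const TYPE('n) R \<alpha> p \<le> rayleigh R \<alpha> p u g"
  unfolding S_const_def
proof (rule cInf_lower)
  show "bdd_below {rayleigh R \<alpha> p u g |(u :: real^'n \<Rightarrow> real) g. H10 u g \<and> \<not> (AE x in lborel. u x = 0)}"
    by (rule bdd_belowI[of _ 0]) (auto simp: rayleigh_def dirichlet_def)
qed (use assms in blast)

section \<open>The minimiser, its Euler-Lagrange inequality and the lower bound on its
  maximum\<close>

text \<open>\<open>pos_minimiser\<close> hides the weak gradient behind an existential quantifier;
  here it is fixed, so that the infimum can be handled as the energy of \<open>g\<close>, to which
  it is equal by the normalisation.\<close>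

locale normalized_minimiser =
  fixes R \<alpha> p :: real and w :: "real^'n \<Rightarrow> real" and g :: "real^'n \<Rightarrow> real^'n"
  assumes N: "CARD('n) \<ge> 3" and p: "1 < p" and R: "0 < R" "R < 1" and \<alpha>: "0 < \<alpha>"
    and H10: "H10 w g" and wterm: "wterm R \<alpha> p w = 1"
    and min: "rayleigh R \<alpha> p w g = S_const TYPE('n) R \<alpha> p"
    and cont: "continuous_on (cball 0 1) w" and pos: "\<And>x. norm x < 1 \<Longrightarrow> w x > 0"
begin

abbreviation S where "S \<equiv> dirichlet g"
abbreviation V where "V \<equiv> \<lambda>x::real^'n. Vw R \<alpha> (norm x)"

lemma S_const_eq: "S_const TYPE('n) R \<alpha> p = S"
  using min wterm by (simp add: rayleigh_def)

lemma measurable_w [measurable]: "w \<in> borel_measurable borel"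
  and integrable_sq: "integrable lborel (\<lambda>x. (w x)\<^sup>2)"
  and zero_outside: "norm x \<ge> 1 \<Longrightarrow> w x = 0"
  using H10 unfolding H10_def by auto

lemma nonneg: "0 \<le> w x"
  using pos[of x] zero_outside[of x] by (cases "norm x < 1") auto

lemma V_bounds: "norm x < 1 \<Longrightarrow> 0 \<le> V x \<and> V x \<le> 1"
  using R \<alpha> by (auto simp: Vw_nonneg intro!: Vw_le_1)

text \<open>Continuity up to the boundary supplies the bound. It makes all integrals of powers of
  \<open>w\<close> finite without any Sobolev embedding, but it depends on \<open>w\<close> and
  therefore never enters the final constants.\<close>

lemma bounded: obtains B where "B \<ge> 0" "\<And>x. w x \<le> B"
proof -
  have "bounded (w ` cball 0 1)"
    by (intro compact_imp_bounded compact_continuous_image cont compact_cball)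
  then obtain B where B: "\<forall>y\<in>w ` cball 0 1. norm y \<le> B" unfolding bounded_iff by blast
  have "w x \<le> max 0 B" for x
    using bspec[OF B imageI[of x "cball 0 1"]] zero_outside[of x] by (cases "norm x < 1") auto
  then show ?thesis using that[of "max 0 B"] by auto
qed

lemma integrable_V:
  assumes [measurable]: "f \<in> borel_measurable borel" and "\<And>x. norm x < 1 \<Longrightarrow> \<bar>f x\<bar> \<le> C" "\<And>x. norm x \<ge> 1 \<Longrightarrow> f x = 0"
  shows "integrable lborel (\<lambda>x. V x * f x)"
proof (rule integrable_bounded_on_ball[where C=C])
  fix x :: "real^'n" assume x: "norm x < 1"
  then have "\<bar>V x * f x\<bar> \<le> 1 * C"
    unfolding abs_mult using V_bounds[OF x] assms(2)[OF x] by (intro mult_mono) auto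
  then show "\<bar>V x * f x\<bar> \<le> C" by simp
qed (use assms in auto)

lemma integrable_V_powr:
  assumes "q > 0" shows "integrable lborel (\<lambda>x. V x * w x powr q)"
proof -
  obtain B where B: "\<And>x. w x \<le> B" using bounded by blast
  show ?thesis
    by (rule integrable_V[where C="B powr q"])
       (use assms B nonneg zero_outside in \<open>auto intro!: powr_mono2\<close>)
qed

lemma integral_V_powr: "(LINT x|lborel. V x * w x powr (p + 1)) = 1"
  using wterm nonneg by (simp add: wterm_def)

text \<open>This is the weak form of -\<Delta>w \<le> S V w^p. Were it to fail for some
  \<open>\<phi>\<close>, moving from \<open>w\<close> to \<open>w - l \<phi>\<close> with small
  \<open>l > 0\<close> would lower the energy faster than the constraint term permits, so the
  Rayleigh quotient would drop below its infimum.\<close>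

lemma Euler_Lagrange_le:
  assumes \<phi>: "Cc1_ball \<phi> d\<phi>" and \<phi>0: "\<And>x. \<phi> x \<ge> 0"
  shows "(LINT x|lborel. g x \<bullet> d\<phi> x) \<le> S * (LINT x|lborel. V x * (w x powr p * \<phi> x))"
proof (rule ccontr)
  define G where "G = (LINT x|lborel. g x \<bullet> d\<phi> x)"
  define I where "I = (LINT x|lborel. V x * (w x powr p * \<phi> x))"
  define D where "D = dirichlet d\<phi>"
  assume "\<not> ?thesis"
  then have neg: "S * I < G" by (simp add: G_def I_def)
  note \<phi>' [measurable] = Cc1_ball_L2(1)[OF \<phi>]
  obtain K where K: "continuous_on UNIV \<phi>" "compact K" "K \<subseteq> ball 0 1" "\<And>x. x \<notin> K \<Longrightarrow> \<phi> x = 0"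
    using Cc1_ballE[OF \<phi>] by metis
  have \<phi>z: "\<phi> x = 0" if "norm x \<ge> 1" for x using that K(3,4) by force
  obtain B where B: "B \<ge> 0" "\<And>x. w x \<le> B" using bounded by blast
  obtain F where F: "F \<ge> 0" "\<And>x. norm (\<phi> x) \<le> F"
    using bounded_continuous_compact_support[OF K(1,2,4)] by blast
  have i1: "integrable lborel (\<lambda>x. V x * (w x powr p * \<phi> x))"
  proof (rule integrable_V[where C="B powr p * F"])
    show "\<bar>w x powr p * \<phi> x\<bar> \<le> B powr p * F" for x
      unfolding abs_mult using B F(2)[of x] p nonneg by (intro mult_mono) (auto intro!: powr_mono2)
  qed (auto simp: \<phi>z)
  have I0: "I \<ge> 0" unfolding I_def
    by (intro Bochner_Integration.integral_nonneg mult_nonneg_nonneg) (auto simp: \<phi>0 Vw_nonneg)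
  have key: "S * (1 - (p + 1) * l * I) powr (2 / (p + 1)) \<le> S - 2 * l * G + l\<^sup>2 * D"
    if l: "l > 0" "(p + 1) * l * I < 1" for l
  proof -
    define v where "v x = w x - l * \<phi> x" for x
    have [measurable]: "v \<in> borel_measurable borel" unfolding v_def[abs_def] by measurable
    have i2: "integrable lborel (\<lambda>x. V x * \<bar>v x\<bar> powr (p + 1))"
    proof (rule integrable_V[where C="(B + l * F) powr (p + 1)"])
      show "\<bar>\<bar>v x\<bar> powr (p + 1)\<bar> \<le> (B + l * F) powr (p + 1)" for x
      proof -
        have "\<bar>v x\<bar> \<le> \<bar>w x\<bar> + \<bar>l * \<phi> x\<bar>" unfolding v_def by simp
        also have "\<dots> \<le> B + l * F"
          unfolding abs_mult using B F(2)[of x] l nonneg[of x] by (intro add_mono mult_mono) auto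
        finally show ?thesis using p by (auto intro!: powr_mono2)
      qed
    qed (auto simp: v_def \<phi>z zero_outside)
    have "V x * w x powr (p + 1) - (p + 1) * l * (V x * (w x powr p * \<phi> x)) \<le> V x * \<bar>v x\<bar> powr (p + 1)" for x
      using mult_left_mono[OF powr_tangent_le[OF nonneg[of x], of "p + 1" "l * \<phi> x"], of "V x"] p
      by (simp add: v_def Vw_nonneg algebra_simps)
    then have "(LINT x|lborel. V x * w x powr (p + 1) - (p + 1) * l * (V x * (w x powr p * \<phi> x)))
        \<le> (LINT x|lborel. V x * \<bar>v x\<bar> powr (p + 1))"
      using i1 i2 integrable_V_powr[of "p + 1"] p by (intro integral_mono) auto
    then have W: "1 - (p + 1) * l * I \<le> wterm R \<alpha> p v"
      using i1 integrable_V_powr[of "p + 1"] p by (simp add: wterm_def I_def integral_V_powr)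
    have ne: "\<not> (AE x in lborel. v x = 0)"
    proof
      assume "AE x in lborel. v x = 0"
      then have "AE x in lborel. V x * \<bar>v x\<bar> powr (p + 1) = 0" by eventually_elim simp
      then have "wterm R \<alpha> p v = 0" unfolding wterm_def by (rule integral_eq_zero_AE)
      then show False using W l by simp
    qed
    have "H10 v (\<lambda>x. g x - l *\<^sub>R d\<phi> x)"
      unfolding v_def[abs_def] by (rule H10_minus_Cc1_ball(1)[OF H10 \<phi>])
    then have "S \<le> rayleigh R \<alpha> p v (\<lambda>x. g x - l *\<^sub>R d\<phi> x)"
      using S_const_le_rayleigh[OF _ ne, of _ R \<alpha> p] by (simp add: S_const_eq)
    also have "\<dots> = (S - 2 * l * G + l\<^sup>2 * D) / wterm R \<alpha> p v powr (2 / (p + 1))"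
      unfolding rayleigh_def H10_minus_Cc1_ball(2)[OF H10 \<phi>] by (simp add: G_def D_def)
    finally have "S * wterm R \<alpha> p v powr (2 / (p + 1)) \<le> S - 2 * l * G + l\<^sup>2 * D"
      using W l by (simp add: field_simps)
    moreover have "(1 - (p + 1) * l * I) powr (2 / (p + 1)) \<le> wterm R \<alpha> p v powr (2 / (p + 1))"
      using W l p by (intro powr_mono2) auto
    moreover have "S \<ge> 0" unfolding dirichlet_def by simp
    ultimately show ?thesis by (meson mult_left_mono order_trans)
  qed
  define f where "f l = S - 2 * l * G + l\<^sup>2 * D - S * (1 - (p + 1) * l * I) powr (2 / (p + 1))" for l
  \<comment> \<open>The factor \<open>p + 1\<close> from the linear loss in the constraint cancels
    the exponent \<open>2 / (p + 1)\<close>, leaving \<open>2 * (S * I)\<close>, which the assumed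
    strict inequality makes smaller than \<open>2 * G\<close>.\<close>
  have "(f has_real_derivative (- 2 * G + 2 * (S * I))) (at 0)"
    unfolding f_def using p by (auto intro!: derivative_eq_intros simp: field_simps)
  then obtain e where e: "e > 0" "\<And>h. 0 < h \<Longrightarrow> h < e \<Longrightarrow> f h < f 0"
    using DERIV_neg_dec_right[of f "- 2 * G + 2 * (S * I)" 0] neg by auto
  \<comment> \<open>The first bound keeps \<open>l\<close> where \<open>f\<close> is below
    \<open>f 0\<close>, the second keeps \<open>(p + 1) * l * I\<close> below 1 as
    \<open>key\<close> requires; \<open>I + 1\<close> avoids a zero denominator.\<close>
  define l where "l = min (e / 2) (1 / (2 * (p + 1) * (I + 1)))"
  have l: "0 < l" "l < e" using e(1) p I0 by (auto simp: l_def)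
  have "(p + 1) * l * I \<le> (p + 1) * (1 / (2 * (p + 1) * (I + 1))) * I"
    using p I0 by (intro mult_right_mono mult_left_mono) (auto simp: l_def)
  also have "\<dots> = I / (2 * (I + 1))"
  proof -
    have "a * (1 / (2 * a * b)) * I = I / (2 * b)" if "a \<noteq> 0" for a b using that by simp
    from this[of "p + 1" "I + 1"] p show ?thesis by simp
  qed
  also have "\<dots> < 1" using I0 by (simp add: divide_less_eq)
  finally have "f l \<ge> 0" using key[of l] l by (simp add: f_def)
  moreover have "f 0 = 0" by (simp add: f_def)
  ultimately show False using e(2)[OF l] by simp
qed

text \<open>Zero energy would make \<open>w\<close> vanish almost everywhere by Poincare, against
  the normalisation.\<close>

lemma minimum_pos: "0 < S"
proof -
  have "S \<ge> 0" unfolding dirichlet_def by simp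
  moreover have "S \<noteq> 0"
  proof
    assume "S = 0"
    then have "(LINT x|lborel. (w x)\<^sup>2) = 0"
      using Poincare_H10[OF H10] by (simp add: antisym)
    then have "AE x in lborel. (w x)\<^sup>2 = 0"
      using integral_nonneg_eq_0_iff_AE[OF integrable_sq] by simp
    then have "AE x in lborel. V x * w x powr (p + 1) = 0" by eventually_elim simp
    then have "(LINT x|lborel. V x * w x powr (p + 1)) = 0" by (rule integral_eq_zero_AE)
    then show False using integral_V_powr by simp
  qed
  ultimately show ?thesis by simp
qed

text \<open>In the normalisation integral, \<open>p - 1\<close> powers of \<open>w\<close> are
  replaced by \<open>M\<close>, which leaves the quadratic integral controlled by the weighted
  Poincare inequality; the 40 is its constant.\<close>

lemma max_lower_bound:
  assumes M: "\<And>x. w x \<le> M"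
  shows "\<alpha>\<^sup>2 \<le> 40 * S * M powr (p - 1)"
proof -
  have M0: "0 \<le> M" using M[of 0] nonneg[of 0] by simp
  have i: "integrable lborel (\<lambda>x. V x * (w x)\<^sup>2)"
    by (rule integrable_V[where C="M\<^sup>2"]) (use M nonneg zero_outside in \<open>auto intro!: power_mono\<close>)
  have "V x * w x powr (p + 1) \<le> M powr (p - 1) * (V x * (w x)\<^sup>2)" for x
  proof -
    have "w x powr (p + 1) = w x powr (p - 1) * (w x)\<^sup>2"
    proof (cases "w x = 0")
      case False
      then have "w x > 0" using nonneg[of x] by simp
      then have "w x powr (p - 1) * (w x)\<^sup>2 = w x powr (p - 1) * w x powr 2" by (simp add: powr_numeral)
      also have "\<dots> = w x powr (p + 1)" by (simp add: powr_add[symmetric] add.commute)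
      finally show ?thesis by simp
    qed simp
    also have "\<dots> \<le> M powr (p - 1) * (w x)\<^sup>2"
      using M nonneg p by (intro mult_right_mono powr_mono2) auto
    finally show ?thesis using mult_left_mono[of _ _ "V x"] by (fastforce simp: Vw_nonneg mult_ac)
  qed
  then have "(LINT x|lborel. V x * w x powr (p + 1)) \<le> (LINT x|lborel. M powr (p - 1) * (V x * (w x)\<^sup>2))"
    using i integrable_V_powr[of "p + 1"] p by (intro integral_mono) auto
  then have "1 \<le> M powr (p - 1) * (LINT x|lborel. V x * (w x)\<^sup>2)"
    by (simp add: integral_V_powr)
  also have "\<dots> \<le> M powr (p - 1) * (40 / \<alpha>\<^sup>2 * S)"
    using weighted_Poincare_H10[OF H10 N R \<alpha>] by (intro mult_left_mono) auto
  finally show ?thesis using \<alpha> by (simp add: field_simps)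
qed

end

section \<open>Upper bound for the infimum\<close>

lemma measure_lborel_cball:
  assumes "r \<ge> 0"
  shows "measure lborel (cball (c::real^'n) r) = unit_ball_vol (real CARD('n)) * r powr real CARD('n)"
proof (cases "r = 0")
  case True
  then show ?thesis using content_cball[OF assms, of c] by (simp add: zero_power)
next
  case False
  then show ?thesis using content_cball[OF assms, of c] assms by (simp add: powr_realpow)
qed

lemma integrable_indicator_cball [simp]:
  "integrable lborel (\<lambda>x. indicator (cball (c::real^'n) r) x * (C::real))"
  using borel_integrable_compact[of "cball c r" "\<lambda>_. C"] by simp

text \<open>For x = r/R \<le> 1/2 one has ln (1 - x) \<ge> - 2 x, and the radius is chosen so that 2
  \<alpha> x \<le> 1.\<close>

lemma Vw_near_origin_ge:
  assumes R: "0 < R" "R < 1" and \<alpha>: "\<alpha> \<ge> 1" and r: "0 \<le> r" "r \<le> R / (2 * \<alpha>)"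
  shows "exp (- 1) \<le> Vw R \<alpha> r"
proof -
  define x where "x = r / R"
  have x: "0 \<le> x" "x \<le> 1 / (2 * \<alpha>)" using R r \<alpha> by (auto simp: x_def field_simps)
  have "1 / (2 * \<alpha>) \<le> 1 / 2" using \<alpha> by simp
  then have x2: "x \<le> 1 / 2" using x by linarith
  have "- x - 2 * x\<^sup>2 \<le> ln (1 - x)" using ln_one_minus_pos_lower_bound[OF x(1) x2] .
  moreover have "2 * x\<^sup>2 \<le> x" using mult_right_mono[OF x2 x(1)] by (simp add: power2_eq_square)
  ultimately have "- (2 * x) \<le> ln (1 - x)" by linarith
  then have "\<alpha> * (- (2 * x)) \<le> \<alpha> * ln (1 - x)" using \<alpha> by (intro mult_left_mono) auto
  moreover have "2 * \<alpha> * x \<le> 1" using mult_left_mono[OF x(2), of "2 * \<alpha>"] \<alpha> by simp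
  ultimately have "- 1 \<le> \<alpha> * ln (1 - x)" by linarith
  moreover have "r < R" using x2 R r by (simp add: x_def field_simps)
  ultimately show ?thesis using x2 by (simp add: Vw_def powr_def x_def[symmetric])
qed

text \<open>The competitor is the bump (1 - \<alpha>^2 |x|^2)^2 on the ball of radius 1/\<alpha>.
  Its energy is of order \<alpha>^(2-N), and its constraint integral is at least of order
  \<alpha>^(-N) because the weight does not degenerate at that scale; the exponent is that of the
  resulting quotient.\<close>

lemma S_const_upper_bound:
  fixes R p :: real
  assumes p: "1 < p" and R: "0 < R" "R < 1"
  defines "N \<equiv> real CARD('n::finite)"
  shows "\<exists>C>0. \<forall>\<alpha>\<ge>2. S_const TYPE('n) R \<alpha> p \<le> C * \<alpha> powr (2 - N + 2 * N / (p + 1))"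
proof -
  define \<omega> where "\<omega> = unit_ball_vol N"
  have \<omega>: "\<omega> > 0" by (simp add: \<omega>_def N_def)
  \<comment> \<open>On the ball of radius \<open>R / (2 * \<alpha>)\<close> the weight is at least
    \<open>exp (- 1)\<close> and the bump at least 1/2, so \<open>c\<close> times \<alpha>^(-N)
    bounds the constraint integral from below. The \<open>16 * \<omega>\<close> in \<open>C\<close>
    comes from a gradient of size at most 4 \<alpha> on a ball of volume \<omega>
    \<alpha>^(-N).\<close>
  define c where "c = exp (- 1) * (1 / 2) powr (p + 1) * \<omega> * (R / 2) powr N"
  have c: "c > 0" using \<omega> R by (simp add: c_def)
  define C where "C = 16 * \<omega> / c powr (2 / (p + 1))"
  have C: "C > 0" using \<omega> c by (simp add: C_def)
  have "S_const TYPE('n) R \<alpha> p \<le> C * \<alpha> powr (2 - N + 2 * N / (p + 1))" if \<alpha>: "\<alpha> \<ge> 2" for \<alpha>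
  proof -
    define d where "d = 1 / \<alpha>"
    have d: "0 < d" "d \<le> 1 / 2" using \<alpha> by (auto simp: d_def field_simps)
    \<comment> \<open>The square makes the profile and its derivative both vanish at
      \<open>d\<^sup>2\<close>, so truncation there is continuously differentiable.\<close>
    define K where "K t = (1 - \<alpha>\<^sup>2 * t)\<^sup>2" for t
    define K' where "K' t = - 2 * \<alpha>\<^sup>2 * (1 - \<alpha>\<^sup>2 * t)" for t
    define H where "H t = K (min t (d\<^sup>2))" for t
    define H' where "H' t = K' (min t (d\<^sup>2))" for t
    have Kd: "K (d\<^sup>2) = 0" "K' (d\<^sup>2) = 0" using \<alpha> by (auto simp: K_def K'_def d_def power2_eq_square)
    have "(K has_real_derivative K' t) (at t)" for t
      unfolding K_def K'_def by (auto intro!: derivative_eq_intros)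
    then have HH': "(H has_real_derivative H' t) (at t)" for t
      unfolding H_def H'_def by (intro DERIV_min_glue Kd)
    define \<phi> where "\<phi> x = H ((norm (x - 0))\<^sup>2)" for x :: "real^'n"
    define d\<phi> where "d\<phi> x = (2 * H' ((norm (x - 0))\<^sup>2)) *\<^sub>R (x - 0)" for x :: "real^'n"
    have Cc: "Cc1_ball \<phi> d\<phi>"
      unfolding \<phi>_def d\<phi>_def
    proof (rule Cc1_ball_radial[OF HH' _ _ d(1)])
      show "continuous_on {0..} H'" unfolding H'_def K'_def by (intro continuous_intros)
      show "H t = 0" if "d\<^sup>2 \<le> t" for t using that Kd by (simp add: H_def)
    qed (use d in auto)
    note [measurable] = Cc1_ball_L2(1,2)[OF Cc]
    have t: "\<alpha>\<^sup>2 * (norm x)\<^sup>2 \<le> 1" if "norm x \<le> d" for x :: "real^'n"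
    proof -
      have "\<alpha> * norm x \<le> \<alpha> * d" using that \<alpha> by (intro mult_left_mono) auto
      also have "\<dots> = 1" using \<alpha> by (simp add: d_def)
      finally have "(\<alpha> * norm x)\<^sup>2 \<le> 1" using \<alpha> by (simp add: power_le_one)
      then show ?thesis by (simp add: power_mult_distrib)
    qed
    have in_d: "(norm x)\<^sup>2 \<le> d\<^sup>2 \<longleftrightarrow> norm x \<le> d" for x :: "real^'n"
      using d by (simp add: abs_le_square_iff[symmetric])
    have "norm (d\<phi> x) \<le> 4 * \<alpha>" if "norm x \<le> d" for x
    proof -
      have "\<bar>1 - \<alpha>\<^sup>2 * (norm x)\<^sup>2\<bar> \<le> 1" using t[OF that] by (simp add: abs_le_iff)
      moreover have "H' ((norm x)\<^sup>2) = - 2 * \<alpha>\<^sup>2 * (1 - \<alpha>\<^sup>2 * (norm x)\<^sup>2)"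
        using that in_d[of x] by (simp add: H'_def K'_def min_absorb1)
      then have "norm (d\<phi> x) = 4 * \<alpha>\<^sup>2 * \<bar>1 - \<alpha>\<^sup>2 * (norm x)\<^sup>2\<bar> * norm x"
        by (simp add: d\<phi>_def abs_mult)
      moreover have "4 * \<alpha>\<^sup>2 * \<bar>1 - \<alpha>\<^sup>2 * (norm x)\<^sup>2\<bar> * norm x \<le> 4 * \<alpha>\<^sup>2 * 1 * d"
        using that calculation(1) by (intro mult_mono) auto
      ultimately have "norm (d\<phi> x) \<le> 4 * \<alpha>\<^sup>2 * 1 * d" by simp
      also have "\<dots> = 4 * \<alpha>" using \<alpha> by (simp add: d_def power2_eq_square)
      finally show ?thesis .
    qed
    moreover have "d\<phi> x = 0" if "\<not> norm x \<le> d" for x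
      using that in_d[of x] Kd by (simp add: d\<phi>_def H'_def)
    ultimately have "(norm (d\<phi> x))\<^sup>2 \<le> indicator (cball 0 d) x * (4 * \<alpha>)\<^sup>2" for x
      using power_mono[of "norm (d\<phi> x)" "4 * \<alpha>" 2] by (cases "norm x \<le> d") auto
    then have "dirichlet d\<phi> \<le> (LINT x|lborel. indicator (cball (0::real^'n) d) x * (4 * \<alpha>)\<^sup>2)"
      unfolding dirichlet_def by (intro integral_mono Cc1_ball_L2(4)[OF Cc] integrable_indicator_cball)
    also have "\<dots> = 16 * \<alpha>\<^sup>2 * (\<omega> * d powr N)"
      using measure_lborel_cball[of d "0::real^'n"] d by (simp add: \<omega>_def N_def)
    also have "\<dots> = 16 * \<omega> * \<alpha> powr (2 - N)"
      using \<alpha> by (simp add: d_def powr_divide powr_diff powr_numeral)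
    finally have D: "dirichlet d\<phi> \<le> 16 * \<omega> * \<alpha> powr (2 - N)" .
    have \<phi>b: "0 \<le> \<phi> x" "\<phi> x \<le> 1" for x
    proof -
      show "0 \<le> \<phi> x" by (simp add: \<phi>_def H_def K_def)
      have "\<bar>1 - \<alpha>\<^sup>2 * (norm x)\<^sup>2\<bar> \<le> 1" if "norm x \<le> d" using t[OF that] by (simp add: abs_le_iff)
      then show "\<phi> x \<le> 1"
        using in_d[of x] Kd abs_square_le_1[of "1 - \<alpha>\<^sup>2 * (norm x)\<^sup>2"]
        by (cases "norm x \<le> d") (auto simp: \<phi>_def H_def K_def[of "(norm x)\<^sup>2"] min_absorb1)
    qed
    have \<phi>l: "1 / 2 \<le> \<phi> x" if "norm x \<le> R / (2 * \<alpha>)" for x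
    proof -
      have "R / (2 * \<alpha>) \<le> d" using R \<alpha> by (simp add: d_def field_simps)
      then have xd: "norm x \<le> d" using that by simp
      have "\<alpha> * norm x \<le> 1 / 2"
        using mult_left_mono[OF that, of \<alpha>] R \<alpha> by (simp add: field_simps)
      then have "(\<alpha> * norm x)\<^sup>2 \<le> (1 / 2)\<^sup>2" using \<alpha> by (intro power_mono) auto
      then have "\<alpha>\<^sup>2 * (norm x)\<^sup>2 \<le> 1 / 4" by (simp add: power_mult_distrib power_divide)
      then have "3 / 4 \<le> 1 - \<alpha>\<^sup>2 * (norm x)\<^sup>2" by simp
      then have "(3 / 4)\<^sup>2 \<le> (1 - \<alpha>\<^sup>2 * (norm x)\<^sup>2)\<^sup>2" by (intro power_mono) auto
      then show ?thesis using xd in_d[of x] by (simp add: \<phi>_def H_def K_def min_absorb1 power2_eq_square)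
    qed
    have iV: "integrable lborel (\<lambda>x. Vw R \<alpha> (norm x) * \<bar>\<phi> x\<bar> powr (p + 1))"
    proof (rule integrable_bounded_on_ball[where C=1])
      fix x :: "real^'n"
      show "\<bar>Vw R \<alpha> (norm x) * \<bar>\<phi> x\<bar> powr (p + 1)\<bar> \<le> 1" if "norm x < 1"
        using Vw_le_1[OF R, of "norm x" \<alpha>] Vw_nonneg[of R \<alpha> "norm x"] \<phi>b[of x] that \<alpha> p
        by (auto simp: abs_mult intro!: mult_le_one powr_le1)
      show "Vw R \<alpha> (norm x) * \<bar>\<phi> x\<bar> powr (p + 1) = 0" if "norm x \<ge> 1"
        using that d in_d[of x] Kd by (simp add: \<phi>_def H_def)
    qed simp
    have "indicator (cball 0 (R / (2 * \<alpha>))) x * (exp (- 1) * (1 / 2) powr (p + 1)) \<le>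
        Vw R \<alpha> (norm x) * \<bar>\<phi> x\<bar> powr (p + 1)" for x :: "real^'n"
    proof (cases "norm x \<le> R / (2 * \<alpha>)")
      case True
      then show ?thesis
        using Vw_near_origin_ge[OF R _ _ True] \<alpha> \<phi>l[OF True] p
        by (auto intro!: mult_mono powr_mono2 Vw_nonneg)
    qed (simp add: Vw_nonneg)
    then have "(LINT x|lborel. indicator (cball (0::real^'n) (R / (2 * \<alpha>))) x * (exp (- 1) * (1 / 2) powr (p + 1)))
        \<le> wterm R \<alpha> p \<phi>"
      unfolding wterm_def by (intro integral_mono iV integrable_indicator_cball)
    also have "(LINT x|lborel. indicator (cball (0::real^'n) (R / (2 * \<alpha>))) x * (exp (- 1) * (1 / 2) powr (p + 1)))
        = exp (- 1) * (1 / 2) powr (p + 1) * (\<omega> * (R / (2 * \<alpha>)) powr N)"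
      using measure_lborel_cball[of "R / (2 * \<alpha>)" "0::real^'n"] R \<alpha> by (simp add: \<omega>_def N_def)
    also have "\<dots> = c * \<alpha> powr (- N)"
    proof -
      have "(R / (2 * \<alpha>)) powr N = (R / 2) powr N * \<alpha> powr (- N)"
        using R \<alpha> by (simp add: powr_divide powr_mult powr_minus field_simps)
      then show ?thesis by (simp add: c_def)
    qed
    finally have W: "c * \<alpha> powr (- N) \<le> wterm R \<alpha> p \<phi>" .
    have Wp: "0 < c * \<alpha> powr (- N)" using c \<alpha> by simp
    have ne: "\<not> (AE x in lborel. \<phi> x = 0)"
    proof
      assume "AE x in lborel. \<phi> x = 0"
      then have "AE x in lborel. Vw R \<alpha> (norm x) * \<bar>\<phi> x\<bar> powr (p + 1) = 0" by eventually_elim simp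
      then have "wterm R \<alpha> p \<phi> = 0" unfolding wterm_def by (rule integral_eq_zero_AE)
      then show False using W Wp by simp
    qed
    have "S_const TYPE('n) R \<alpha> p \<le> rayleigh R \<alpha> p \<phi> d\<phi>"
      by (rule S_const_le_rayleigh[OF H10_Cc1_ball[OF Cc] ne])
    also have "\<dots> \<le> (16 * \<omega> * \<alpha> powr (2 - N)) / (c * \<alpha> powr (- N)) powr (2 / (p + 1))"
      unfolding rayleigh_def
      using D W Wp p \<omega> by (intro frac_le) (auto intro!: powr_mono2)
    also have "\<dots> = C * \<alpha> powr (2 - N + 2 * N / (p + 1))"
    proof -
      have "(c * \<alpha> powr (- N)) powr (2 / (p + 1)) = c powr (2 / (p + 1)) * \<alpha> powr (- (2 * N / (p + 1)))"
        using c \<alpha> by (simp add: powr_mult powr_powr mult.commute)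
      moreover have "\<alpha> powr (2 - N + 2 * N / (p + 1)) = \<alpha> powr (2 - N) / \<alpha> powr (- (2 * N / (p + 1)))"
        by (simp only: powr_add powr_minus divide_inverse inverse_inverse_eq)
      ultimately show ?thesis unfolding C_def by simp
    qed
    finally show ?thesis .
  qed
  then show ?thesis using C by blast
qed

section \<open>Local integrability of the regularised Riesz kernel\<close>

text \<open>The divergence theorem replaces polar coordinates. The field k(t) (x - c) with k(t) = (e
  + t)^(-j), t = |x - c|^2, has divergence 2 t k' + N k, which is at least (N - 2j) k. Once
  truncated the field has total divergence zero, so the kernel is controlled by the truncation
  terms, and these are bounded uniformly in \<open>e\<close>.\<close>

lemma integral_Riesz_kernel_bound:
  fixes c :: "real^'n"
  assumes d: "0 < d" and c: "norm c + d < 1" and e: "e > 0"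
    and j: "0 < j" "2 * j < real CARD('n)"
  shows "(LINT x|lborel. indicator (cball c d) x * (e + (norm (x - c))\<^sup>2) powr (- j)) \<le>
     real CARD('n) * (1 + j) * d powr (- 2 * j) * measure lborel (cball c d) / (real CARD('n) - 2 * j)"
proof -
  let ?N = "real CARD('n)"
  let ?t = "\<lambda>x. (norm (x - c))\<^sup>2"
  define T where "T = d\<^sup>2"
  have T: "T > 0" using d by (simp add: T_def)
  define k where "k t = (e + t) powr (- j)" for t
  define k' where "k' t = - j * (e + t) powr (- j - 1)" for t
  \<comment> \<open>Subtracting the tangent at \<open>T\<close> makes value and slope vanish there,
    as needed for the extension by zero.\<close>
  define K where "K t = k t - k T - k' T * (t - T)" for t
  define K' where "K' t = k' t - k' T" for t
  define H where "H t = K (min t T)" for t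
  define H' where "H' t = K' (min t T)" for t
  have KT: "K T = 0" "K' T = 0" by (auto simp: K_def K'_def)
  have k: "(k has_real_derivative k' t) (at t)" if "0 \<le> t" for t
    unfolding k_def k'_def using that e by (auto intro!: derivative_eq_intros)
  have K: "(K has_real_derivative K' t) (at t)" if "0 \<le> t" for t
    unfolding K_def K'_def using that by (auto intro!: derivative_eq_intros k)
  have HH': "(H has_real_derivative H' t) (at t)" if "0 \<le> t" for t
    unfolding H_def H'_def by (intro DERIV_min_glue KT K) (use that T in auto)
  have Cc: "Cc1_ball (\<lambda>x. H (?t x)) (\<lambda>x. (2 * H' (?t x)) *\<^sub>R (x - c))"
  proof (rule Cc1_ball_radial[OF HH' _ _ d c])
    show "continuous_on {0..} H'" unfolding H'_def K'_def k'_def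
      using e T by (auto intro!: continuous_intros)
    show "H t = 0" if "d\<^sup>2 \<le> t" for t using that KT by (simp add: H_def T_def)
  qed
  obtain A where A: "\<And>x. ((\<lambda>x. H (?t x)) has_derivative (\<lambda>h. ((2 * H' (?t x)) *\<^sub>R (x - c)) \<bullet> h)) (at x)"
     "continuous_on UNIV (\<lambda>x. (2 * H' (?t x)) *\<^sub>R (x - c))" "continuous_on UNIV (\<lambda>x. H (?t x))"
     "compact A" "\<And>x. x \<notin> A \<Longrightarrow> H (?t x) = 0" "\<And>x. x \<notin> A \<Longrightarrow> (2 * H' (?t x)) *\<^sub>R (x - c) = 0"
    using Cc1_ballE[OF Cc] by metis
  have eq: "(LINT x|lborel. ((2 * H' (?t x)) *\<^sub>R (x - c)) \<bullet> (x - c)) = - ?N * (LINT x|lborel. H (?t x))"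
    using integral_radial_derivative[OF A(1,2,4,5), of c] by simp
  have i1: "integrable lborel (\<lambda>x. H (?t x))" by (rule integrable_continuous_compact_support[OF A(3,4,5)])
  have i2: "integrable lborel (\<lambda>x. ((2 * H' (?t x)) *\<^sub>R (x - c)) \<bullet> (x - c))"
  proof (rule integrable_continuous_compact_support[OF _ A(4)])
    show "continuous_on UNIV (\<lambda>x. ((2 * H' (?t x)) *\<^sub>R (x - c)) \<bullet> (x - c))"
      by (rule continuous_on_inner[OF A(2)]) (intro continuous_intros)
    show "((2 * H' (?t x)) *\<^sub>R (x - c)) \<bullet> (x - c) = 0" if "x \<notin> A" for x
      by (subst A(6)[OF that]) simp
  qed
  have i3: "integrable lborel (\<lambda>x. indicator (cball c d) x * (e + ?t x) powr (- j))"
    using borel_integrable_compact[of "cball c d" "\<lambda>x. (e + ?t x) powr (- j)"] e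
    by (force intro!: continuous_intros simp: add_nonneg_eq_0_iff)
  \<comment> \<open>\<open>B\<close> bounds what the tangent contributes to the divergence: its
    value on \<open>{0..T}\<close> is at most \<open>k T - k' T * T\<close>, and these two terms
    account for the 1 and the \<open>j\<close> in \<open>1 + j\<close>.\<close>
  define B where "B = ?N * (1 + j) * T powr (- j)"
  have pt: "(?N - 2 * j) * (indicator (cball c d) x * (e + ?t x) powr (- j)) - indicator (cball c d) x * B
       \<le> ((2 * H' (?t x)) *\<^sub>R (x - c)) \<bullet> (x - c) + ?N * H (?t x)" for x
  proof (cases "norm (x - c) \<le> d")
    case True
    define t where "t = ?t x"
    have t: "0 \<le> t" "t \<le> T" using True d by (auto simp: t_def T_def intro!: power_mono)
    have "k t = (e + t) * (e + t) powr (- j - 1)"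
      unfolding k_def using powr_mult_base[of "e + t" "- j - 1"] e t by simp
    then have "2 * t * k' t + ?N * k t = (?N - 2 * j) * k t + 2 * j * e * (e + t) powr (- j - 1)"
      unfolding k'_def by (simp add: algebra_simps)
    moreover have "0 \<le> 2 * j * e * (e + t) powr (- j - 1)" using j e by simp
    ultimately have 1: "(?N - 2 * j) * k t \<le> 2 * t * k' t + ?N * k t" by linarith
    have k'T: "k' T \<le> 0" using j by (simp add: k'_def)
    have kT: "k T \<le> T powr (- j)" unfolding k_def using T e j by (intro powr_mono2') auto
    have "- k' T * T \<le> j * T powr (- j - 1) * T"
      unfolding k'_def using T e j by (intro mult_right_mono) (auto intro!: powr_mono2')
    also have "\<dots> = j * T powr (- j)" using powr_mult_base[of T "- j - 1"] T by (simp add: mult.commute)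
    finally have "- k' T * T \<le> j * T powr (- j)" .
    moreover have "k' T * (t - T) \<le> - k' T * T"
      using mult_nonpos_nonneg[OF k'T t(1)] by (simp add: algebra_simps)
    ultimately have "?N * (k T + k' T * (t - T)) \<le> B"
      unfolding B_def using kT
      by (simp only: mult.assoc) (intro mult_left_mono, auto simp: algebra_simps)
    moreover have "2 * t * k' T \<le> 0" using k'T t by (simp add: mult_nonneg_nonpos)
    ultimately have "(?N - 2 * j) * k t - B \<le> 2 * t * K' t + ?N * K t"
      using 1 unfolding K_def K'_def by (simp add: algebra_simps)
    moreover have "((2 * H' (?t x)) *\<^sub>R (x - c)) \<bullet> (x - c) = 2 * t * K' t"
      using t by (simp add: H'_def t_def[symmetric] power2_norm_eq_inner[symmetric] min_absorb1)
    moreover have "H (?t x) = K t" using t by (simp add: H_def t_def[symmetric] min_absorb1)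
    moreover have "indicator (cball c d) x = (1::real)"
      using True by (simp add: dist_norm norm_minus_commute)
    ultimately show ?thesis unfolding k_def t_def by simp
  next
    case False
    then have "T \<le> ?t x" using d by (auto simp: T_def intro!: power_mono)
    then show ?thesis using False KT by (simp add: H_def H'_def dist_norm norm_minus_commute)
  qed
  have "(LINT x|lborel. (?N - 2 * j) * (indicator (cball c d) x * (e + ?t x) powr (- j)) - indicator (cball c d) x * B)
      \<le> (LINT x|lborel. ((2 * H' (?t x)) *\<^sub>R (x - c)) \<bullet> (x - c) + ?N * H (?t x))"
    by (intro integral_mono pt Bochner_Integration.integrable_diff Bochner_Integration.integrable_add
        integrable_mult_right i1 i2 i3 integrable_indicator_cball)
  also have "\<dots> = 0" using i1 i2 eq by simp
  finally have "(?N - 2 * j) * (LINT x|lborel. indicator (cball c d) x * (e + ?t x) powr (- j))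
      \<le> measure lborel (cball c d) * B"
    using i3 integrable_indicator_cball[of c d B] by simp
  moreover have "T powr (- j) = d powr (- 2 * j)"
  proof -
    have "T = d powr 2" using d by (simp add: T_def)
    then show ?thesis by (simp add: powr_powr)
  qed
  ultimately show ?thesis using j by (simp add: B_def field_simps)
qed

section \<open>Pointwise bound at an interior maximum\<close>

lemma mult_powr_eq:
  fixes x a b :: real
  assumes "0 \<le> x" "b = a + 1"
  shows "x * x powr a = x powr b"
  using powr_mult_base[OF assms(1), of a] assms(2) by (simp add: add.commute)

lemma measurable_truncated_kernel:
  fixes x0 :: "'a::euclidean_space"
  shows "(\<lambda>x. indicator (cball x0 d) x * (e + (norm (x - x0))\<^sup>2) powr a :: real) \<in> borel_measurable borel"
  by (intro borel_measurable_times borel_measurable_indicator powr_real_measurable) auto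

context normalized_minimiser
begin

lemma integrable_w: "integrable lborel w"
proof -
  obtain B where B: "\<And>x. w x \<le> B" using bounded by blast
  show ?thesis
    by (rule integrable_bounded_on_ball[where C=B]) (use B nonneg zero_outside in auto)
qed

text \<open>Cauchy-Schwarz against the indicator of the unit ball, then Poincare; the 2 is the
  square root of the Poincare constant 4.\<close>

lemma integral_le_sqrt_minimum:
  "(LINT x|lborel. w x) \<le> 2 * sqrt S * sqrt (measure lborel (cball (0::real^'n) 1))"
proof -
  have i: "integrable lborel (\<lambda>x::real^'n. (norm (indicator (cball 0 1) x :: real))\<^sup>2)"
  proof -
    have "(\<lambda>x::real^'n. (norm (indicator (cball 0 1) x :: real))\<^sup>2) = (\<lambda>x. indicator (cball 0 1) x * 1)"
      by (auto simp: indicator_def)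
    then show ?thesis using integrable_indicator_cball[of 0 1 1] by simp
  qed
  have "w x = w x \<bullet> indicator (cball 0 1) x" for x
    using zero_outside[of x] by (auto simp: indicator_def)
  then have "(LINT x|lborel. w x) = (LINT x|lborel. w x \<bullet> indicator (cball 0 1) x)"
    by (rule Bochner_Integration.integral_cong[OF refl])
  also have "\<dots> \<le> sqrt (LINT x|lborel. (norm (w x))\<^sup>2) * sqrt (LINT x|lborel. (norm (indicator (cball (0::real^'n) 1) x :: real))\<^sup>2)"
    using integral_Cauchy_Schwarz[of w lborel "indicator (cball 0 1)"] integrable_sq i
    by (simp add: borel_measurable_indicator)
  also have "(LINT x|lborel. (norm (indicator (cball (0::real^'n) 1) x :: real))\<^sup>2) = measure lborel (cball (0::real^'n) 1)"
  proof -
    have "(norm (indicator (cball 0 1) x :: real))\<^sup>2 = indicator (cball 0 1) x" for x :: "real^'n"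
      by (auto simp: indicator_def)
    then show ?thesis by simp
  qed
  also have "sqrt (LINT x|lborel. (norm (w x))\<^sup>2) \<le> sqrt (4 * S)"
    using Poincare_H10[OF H10] by simp
  also have "sqrt (4 * S) = 2 * sqrt S" by (simp add: real_sqrt_mult)
  finally show ?thesis by (simp add: mult_right_mono)
qed

text \<open>The test function is the regularised fundamental solution \<open>(e + |x - x\<^sub>0|\<^sup>2)\<^sup>-\<^sup>k\<close>,
  \<open>k = (N - 2)/2\<close>, minus its second-order Taylor polynomial in \<open>t = |x - x\<^sub>0|\<^sup>2\<close> at \<open>t = d\<^sup>2\<close>;
  this makes its extension by zero twice continuously differentiable.\<close>

lemma pointwise_le_mean_plus_potential:
  fixes x0 :: "real^'n"
  defines "N \<equiv> real CARD('n)"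
  defines "k \<equiv> (N - 2) / 2"
  assumes e: "e > 0" "sqrt e \<le> d" and low: "\<And>x. norm (x - x0) \<le> sqrt e \<Longrightarrow> M / 2 \<le> w x" and M: "0 \<le> M"
    and x0: "norm x0 + d < 1"
  shows "N * k * 2 powr (- k - 2) * unit_ball_vol N * M \<le>
     2 * N * k * (k + 2) * (d\<^sup>2) powr (- k - 1) * (LINT x|lborel. w x) +
     S * (LINT x|lborel. V x * (w x powr p * (indicator (cball x0 d) x * (e + (norm (x - x0))\<^sup>2) powr (- k))))"
proof -
  let ?t = "\<lambda>x. (norm (x - x0))\<^sup>2"
  have N3: "N \<ge> 3" using N by (simp add: N_def)
  then have k0: "k > 0" "N = 2 * k + 2" by (auto simp: k_def field_simps)
  have d: "d > 0" using e real_sqrt_gt_zero[of e] by linarith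
  define T where "T = d\<^sup>2"
  have T: "T > 0" using d by (simp add: T_def)
  define h where "h t = (e + t) powr (- k)" for t
  define h1 where "h1 t = - k * (e + t) powr (- k - 1)" for t
  define h2 where "h2 t = k * (k + 1) * (e + t) powr (- k - 2)" for t
  define K where "K t = h t - h T - h1 T * (t - T) - h2 T * (t - T)\<^sup>2 / 2" for t
  define K1 where "K1 t = h1 t - h1 T - h2 T * (t - T)" for t
  define K2 where "K2 t = h2 t - h2 T" for t
  define H where "H t = K (min t T)" for t
  define H1 where "H1 t = K1 (min t T)" for t
  define H2 where "H2 t = K2 (min t T)" for t
  have KT: "K T = 0" "K1 T = 0" "K2 T = 0" by (auto simp: K_def K1_def K2_def)
  have dh: "(h has_real_derivative h1 t) (at t)" "(h1 has_real_derivative h2 t) (at t)" if "0 \<le> t" for t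
    unfolding h_def h1_def h2_def using that e by (auto intro!: derivative_eq_intros simp: algebra_simps)
  have dK: "(K has_real_derivative K1 t) (at t)" "(K1 has_real_derivative K2 t) (at t)" if "0 \<le> t" for t
    unfolding K_def K1_def K2_def using that by (auto intro!: derivative_eq_intros dh)
  have dH: "(H has_real_derivative H1 t) (at t)" "(H1 has_real_derivative H2 t) (at t)" if "0 \<le> t" for t
    unfolding H_def H1_def H2_def by (intro DERIV_min_glue KT dK; use that T in auto)+
  have cH2: "continuous_on {0..} H2" unfolding H2_def K2_def h2_def
    using e T by (auto intro!: continuous_intros)
  have cH1: "continuous_on {0..} H1" unfolding H1_def K1_def h1_def
    using e T by (auto intro!: continuous_intros)
  have H0: "H t = 0" if "d\<^sup>2 \<le> t" for t using that KT by (simp add: H_def T_def)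
  define \<phi> where "\<phi> x = H (?t x)" for x
  define d\<phi> where "d\<phi> x = (2 * H1 (?t x)) *\<^sub>R (x - x0)" for x
  have Cc: "Cc1_ball \<phi> d\<phi>" unfolding \<phi>_def d\<phi>_def
    by (rule Cc1_ball_radial[OF dH(1) cH1 H0 d x0])
  \<comment> \<open>The signs of \<open>K2\<close>, \<open>K1\<close> and \<open>K\<close> on
    \<open>{0..T}\<close> follow from one another: each vanishes at \<open>T\<close>, so the sign of
    the derivative determines that of the function to the left. Nonnegativity of the test function
    is what the Euler-Lagrange inequality requires.\<close>
  have h2_anti: "h2 s \<le> h2 t" if "0 \<le> t" "t \<le> s" for s t
    unfolding h2_def using that k0 e by (intro mult_left_mono powr_mono2') auto
  have K2_nonneg: "0 \<le> K2 t" if "0 \<le> t" "t \<le> T" for t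
    using h2_anti[OF that] by (simp add: K2_def)
  have K1_nonpos: "K1 t \<le> 0" if "0 \<le> t" "t \<le> T" for t
  proof -
    have "K1 t \<le> K1 T"
    proof (rule DERIV_nonneg_imp_nondecreasing[OF that(2)])
      fix s assume "t \<le> s" "s \<le> T"
      then have "(K1 has_real_derivative K2 s) (at s)" "0 \<le> K2 s" using that dK(2) K2_nonneg by auto
      then show "\<exists>y. (K1 has_real_derivative y) (at s) \<and> 0 \<le> y" by blast
    qed
    then show ?thesis using KT by simp
  qed
  have K_nonneg: "0 \<le> K t" if "0 \<le> t" "t \<le> T" for t
  proof -
    have "K T \<le> K t"
    proof (rule DERIV_nonpos_imp_nonincreasing[OF that(2)])
      fix s assume "t \<le> s" "s \<le> T"
      then have "(K has_real_derivative K1 s) (at s)" "K1 s \<le> 0" using that dK(1) K1_nonpos by auto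
      then show "\<exists>y. (K has_real_derivative y) (at s) \<and> y \<le> 0" by blast
    qed
    then show ?thesis using KT by simp
  qed
  have H_nonneg: "0 \<le> \<phi> x" for x
    unfolding \<phi>_def H_def by (rule K_nonneg) (use T in auto)
  have h2T: "h2 T \<ge> 0" and h1T: "h1 T \<le> 0" and hT: "h T \<ge> 0" using k0 by (auto simp: h2_def h1_def h_def)
  have K_le: "K t \<le> h t" if "t \<le> T" for t
    using mult_nonpos_nonpos[OF h1T, of "t - T"] mult_nonneg_nonneg[OF h2T zero_le_power2[of "t - T"]] that hT
    unfolding K_def by linarith
  have in_d: "?t x \<le> T \<longleftrightarrow> x \<in> cball x0 d" for x
    using d by (simp add: T_def dist_norm norm_minus_commute abs_le_square_iff[symmetric])
  have \<phi>_le: "\<phi> x \<le> indicator (cball x0 d) x * (e + ?t x) powr (- k)" for x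
  proof (cases "?t x \<le> T")
    case True
    then show ?thesis using K_le[OF True] in_d[of x] by (simp add: \<phi>_def H_def h_def min_absorb1)
  next
    case False
    then show ?thesis using KT in_d[of x] by (simp add: \<phi>_def H_def)
  qed
  \<comment> \<open>\<open>L\<close> is minus the Laplacian of \<open>\<phi>\<close>.\<close>
  define L where "L x = - (4 * ?t x * H2 (?t x) + 2 * N * H1 (?t x))" for x
  have wL: "(LINT x|lborel. w x * L x) = (LINT x|lborel. g x \<bullet> d\<phi> x)"
    unfolding d\<phi>_def L_def mult_minus_right Bochner_Integration.integral_minus N_def
    by (rule H10_integral_inner_radial[OF H10 dH cH2 H0 d x0, symmetric])
  \<comment> \<open>The Taylor polynomial lowers minus the Laplacian by at most \<open>C3\<close>;
    its first-order term gives k and its second-order term k (k + 1), together k (k + 2).\<close>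
  define C3 where "C3 = 2 * N * k * (k + 2) * T powr (- k - 1)"
  have C3: "C3 \<ge> 0" using N3 k0 by (simp add: C3_def)
  have Llow: "2 * N * k * e * (e + t) powr (- k - 2) - C3 \<le> - (4 * t * K2 t + 2 * N * K1 t)"
    if t: "0 \<le> t" "t \<le> T" for t
  proof -
    have "(e + t) powr (- k - 1) = (e + t) * (e + t) powr (- k - 2)"
      by (rule mult_powr_eq[symmetric]) (use e t in auto)
    \<comment> \<open>Because N = 2k + 2, the leading powers cancel exactly. What is left of minus
      the Laplacian is a positive approximate delta function of width \<open>sqrt e\<close>.\<close>
    then have 1: "- (4 * t * h2 t + 2 * N * h1 t) = 2 * N * k * e * (e + t) powr (- k - 2)"
      unfolding h1_def h2_def k0(2) by (simp add: algebra_simps)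
    have a: "- h1 T \<le> k * T powr (- k - 1)"
      unfolding h1_def using k0 T e by (simp add: powr_mono2')
    have "h2 T * T \<le> k * (k + 1) * T powr (- k - 2) * T"
      unfolding h2_def using k0 T e by (intro mult_right_mono mult_left_mono powr_mono2') auto
    also have "\<dots> = k * (k + 1) * T powr (- k - 1)"
      using mult_powr_eq[of T "- k - 1" "- k - 2"] T by (simp add: mult.commute)
    finally have b: "h2 T * T \<le> k * (k + 1) * T powr (- k - 1)" .
    have "h2 T * (T - t) \<le> h2 T * T" using h2T t by (intro mult_left_mono) auto
    then have "- h1 T + h2 T * (T - t) \<le> k * (k + 2) * T powr (- k - 1)"
      using a b by (simp add: algebra_simps)
    then have "2 * N * (- h1 T + h2 T * (T - t)) \<le> 2 * N * (k * (k + 2) * T powr (- k - 1))"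
      by (rule mult_left_mono) (use N3 in simp)
    then have "2 * N * (- h1 T + h2 T * (T - t)) \<le> C3" by (simp only: C3_def mult.assoc)
    moreover have "0 \<le> 4 * t * h2 T" using h2T t by simp
    moreover have "- (4 * t * K2 t + 2 * N * K1 t) =
        - (4 * t * h2 t + 2 * N * h1 t) + 4 * t * h2 T - 2 * N * (- h1 T + h2 T * (T - t))"
      unfolding K2_def K1_def by (simp add: algebra_simps)
    ultimately show ?thesis using 1 by linarith
  qed
  \<comment> \<open>On the ball of radius \<open>sqrt e\<close>, \<open>w\<close> is at least
    \<open>M / 2\<close> and \<open>e + t\<close> at most \<open>2 * e\<close>; \<open>A\<close> is
    the product of the resulting lower bounds.\<close>
  define A where "A = M / 2 * (2 * N * k * e * (2 * e) powr (- k - 2))"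
  have pt: "indicator (cball x0 (sqrt e)) x * A - C3 * w x \<le> w x * L x" for x
  proof (cases "?t x \<le> T")
    case True
    have "L x = - (4 * ?t x * K2 (?t x) + 2 * N * K1 (?t x))"
      using True by (simp add: L_def H1_def H2_def min_absorb1)
    then have 1: "2 * N * k * e * (e + ?t x) powr (- k - 2) - C3 \<le> L x"
      using Llow[of "?t x"] True by simp
    have "indicator (cball x0 (sqrt e)) x * A \<le> w x * (2 * N * k * e * (e + ?t x) powr (- k - 2))"
    proof (cases "norm (x - x0) \<le> sqrt e")
      case in_e: True
      have "?t x \<le> (sqrt e)\<^sup>2" using in_e by (intro power_mono) auto
      then have "?t x \<le> e" using e by simp
      then have "(2 * e) powr (- k - 2) \<le> (e + ?t x) powr (- k - 2)"
        using e k0 by (intro powr_mono2') (auto intro: add_pos_nonneg)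
      then have "A \<le> w x * (2 * N * k * e * (e + ?t x) powr (- k - 2))"
        unfolding A_def using low[OF in_e] nonneg[of x] M N3 k0 e by (intro mult_mono mult_left_mono) auto
      then show ?thesis using in_e by (simp add: dist_norm norm_minus_commute)
    next
      case False
      then show ?thesis using nonneg[of x] N3 k0 e by (simp add: dist_norm norm_minus_commute)
    qed
    moreover have "w x * (2 * N * k * e * (e + ?t x) powr (- k - 2) - C3) \<le> w x * L x"
      by (rule mult_left_mono[OF 1 nonneg])
    ultimately show ?thesis by (simp add: algebra_simps)
  next
    case False
    then have "x \<notin> cball x0 d" using in_d by blast
    then have "x \<notin> cball x0 (sqrt e)" using e by auto
    moreover have "L x = 0" using False KT by (simp add: L_def H1_def H2_def)
    ultimately show ?thesis using C3 nonneg[of x] by simp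
  qed
  have cL: "continuous_on UNIV L" unfolding L_def
    by (auto intro!: continuous_intros continuous_on_compose2[OF cH1] continuous_on_compose2[OF cH2])
  have Lz: "L x = 0" if "x \<notin> cball x0 d" for x
    using that in_d[of x] KT by (simp add: L_def H1_def H2_def)
  obtain B where B: "B \<ge> 0" "\<And>x. w x \<le> B" using bounded by blast
  have bdd: "integrable lborel (\<lambda>x. w x * f x)"
    if f: "continuous_on UNIV f" "\<And>x. x \<notin> cball x0 d \<Longrightarrow> f x = 0" for f :: "real^'n \<Rightarrow> real"
  proof -
    obtain F where F: "F \<ge> 0" "\<And>x. norm (f x) \<le> F"
      using bounded_continuous_compact_support[OF f(1) compact_cball[of x0 d]] f(2) by blast
    have [measurable]: "f \<in> borel_measurable borel" using f(1) by (rule borel_measurable_continuous_onI)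
    show ?thesis
    proof (rule integrable_bounded_on_ball[where C="B * F"])
      show "\<bar>w x * f x\<bar> \<le> B * F" for x
        unfolding abs_mult using B F(2)[of x] nonneg by (intro mult_mono) auto
    qed (simp_all add: zero_outside)
  qed
  have "(LINT x|lborel. indicator (cball x0 (sqrt e)) x * A - C3 * w x) \<le> (LINT x|lborel. w x * L x)"
    by (intro integral_mono pt Bochner_Integration.integrable_diff integrable_indicator_cball
        integrable_mult_right integrable_w bdd cL Lz)
  also have "(LINT x|lborel. indicator (cball x0 (sqrt e)) x * A - C3 * w x) =
      measure lborel (cball x0 (sqrt e)) * A - C3 * (LINT x|lborel. w x)"
    using integrable_indicator_cball[of x0 "sqrt e" A] integrable_w by simp
  \<comment> \<open>The ball has volume proportional to e^(k+1), so all powers of \<open>e\<close>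
    cancel: the mass of the approximate delta function does not depend on \<open>e\<close>, although
    \<open>e\<close> depends on \<open>w\<close>.\<close>
  also have "measure lborel (cball x0 (sqrt e)) * A = N * k * 2 powr (- k - 2) * unit_ball_vol N * M"
  proof -
    have "sqrt e powr N = e powr (k + 1)"
      using e k0(2) by (simp add: powr_half_sqrt[symmetric] powr_powr add_divide_distrib)
    moreover have "e powr (k + 1) * e * (2 * e) powr (- k - 2) = 2 powr (- k - 2)"
    proof -
      have "e powr (k + 1) * e = e powr (k + 2)"
        using e mult_powr_eq[of e "k + 2" "k + 1"] by (simp add: mult.commute)
      moreover have "e powr (k + 2) * e powr (- k - 2) = 1"
        using e by (simp add: powr_add[symmetric])
      ultimately show ?thesis using e by (simp add: powr_mult mult_ac)
    qed
    moreover have "measure lborel (cball x0 (sqrt e)) = unit_ball_vol N * sqrt e powr N"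
      using measure_lborel_cball[of "sqrt e" x0] e by (simp add: N_def)
    ultimately have "measure lborel (cball x0 (sqrt e)) * A =
        N * k * unit_ball_vol N * M * (e powr (k + 1) * e * (2 * e) powr (- k - 2))"
      by (simp add: A_def mult_ac)
    then show ?thesis
      unfolding \<open>e powr (k + 1) * e * (2 * e) powr (- k - 2) = 2 powr (- k - 2)\<close> by (simp add: mult_ac)
  qed
  also have "(LINT x|lborel. w x * L x) \<le> S * (LINT x|lborel. V x * (w x powr p * \<phi> x))"
    unfolding wL by (rule Euler_Lagrange_le[OF Cc H_nonneg])
  also have "\<dots> \<le> S * (LINT x|lborel. V x * (w x powr p * (indicator (cball x0 d) x * (e + ?t x) powr (- k))))"
  proof (rule mult_left_mono[OF integral_mono])
    note [measurable] = Cc1_ball_L2(1)[OF Cc]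
    have hb: "0 \<le> indicator (cball x0 d) x * (e + ?t x) powr (- k)"
      "indicator (cball x0 d) x * (e + ?t x) powr (- k) \<le> e powr (- k)" for x
      using e k0 by (auto simp: indicator_def intro!: powr_mono2')
    have wb: "0 \<le> w x powr p" "w x powr p \<le> B powr p" for x
      using B nonneg p by (auto intro!: powr_mono2)
    show "integrable lborel (\<lambda>x. V x * (w x powr p * (indicator (cball x0 d) x * (e + ?t x) powr (- k))))"
    proof (rule integrable_V[where C="B powr p * e powr (- k)"])
      show "\<bar>w x powr p * (indicator (cball x0 d) x * (e + ?t x) powr (- k))\<bar> \<le> B powr p * e powr (- k)" for x
        unfolding abs_mult[of "w x powr p"] abs_of_nonneg[OF hb(1)] abs_of_nonneg[OF wb(1)]
        by (intro mult_mono wb hb) auto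
      show "(\<lambda>x. w x powr p * (indicator (cball x0 d) x * (e + ?t x) powr (- k))) \<in> borel_measurable borel"
        by (intro borel_measurable_times measurable_truncated_kernel) measurable
    qed (auto simp: zero_outside)
    show "integrable lborel (\<lambda>x. V x * (w x powr p * \<phi> x))"
    proof (rule integrable_V[where C="B powr p * e powr (- k)"])
      show "\<bar>w x powr p * \<phi> x\<bar> \<le> B powr p * e powr (- k)" for x
        unfolding abs_mult[of "w x powr p"] abs_of_nonneg[OF H_nonneg] abs_of_nonneg[OF wb(1)]
        by (intro mult_mono wb order_trans[OF \<phi>_le hb(2)] H_nonneg) auto
    qed (auto simp: zero_outside)
    show "V x * (w x powr p * \<phi> x) \<le> V x * (w x powr p * (indicator (cball x0 d) x * (e + ?t x) powr (- k)))" for x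
      by (intro mult_left_mono \<phi>_le) (auto simp: Vw_nonneg)
    show "0 \<le> S" using minimum_pos by simp
  qed
  finally show ?thesis by (simp add: C3_def T_def)
qed

lemma potential_le:
  fixes x0 :: "real^'n"
  defines "N \<equiv> real CARD('n)"
  defines "k \<equiv> (N - 2) / 2"
  assumes M: "\<And>x. w x \<le> M" and d: "0 < d" and x0: "norm x0 + d < 1" and e: "e > 0"
    and V: "\<And>x. norm (x - x0) \<le> d \<Longrightarrow> V x \<le> \<delta>"
    and m: "0 < m" "m \<le> p" and j: "j = k * ((p + 1) / (p + 1 - m))" "2 * j < N" and l: "l > 0"
  shows "(LINT x|lborel. V x * (w x powr p * (indicator (cball x0 d) x * (e + (norm (x - x0))\<^sup>2) powr (- k)))) \<le>
     M powr (p - m) * (l powr ((p + 1) / m) + l powr (- ((p + 1) / (p + 1 - m))) * \<delta> *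
        (N * (1 + j) * d powr (- 2 * j) * measure lborel (cball x0 d) / (N - 2 * j)))"
proof -
  let ?t = "\<lambda>x. (norm (x - x0))\<^sup>2"
  define q where "q = (p + 1) / m"
  define q' where "q' = (p + 1) / (p + 1 - m)"
  have N3: "N \<ge> 3" using N by (simp add: N_def)
  then have k0: "k > 0" by (auto simp: k_def)
  have M0: "M \<ge> 0" using M[of 0] nonneg[of 0] by simp
  have q: "q > 1" "q' > 1" "m * q = p + 1"
    using m p by (auto simp: q_def q'_def field_simps)
  have "1 / q = m / (p + 1)" "1 / q' = (p + 1 - m) / (p + 1)" by (simp_all add: q_def q'_def)
  then have "1 / q + 1 / q' = (m + (p + 1 - m)) / (p + 1)" by (simp only: add_divide_distrib)
  then have qq': "1 / q + 1 / q' = 1" using p by simp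
  have jq: "j = k * q'" using j by (simp add: q'_def)
  have j0: "j > 0" using jq k0 q by simp
  have pt: "V x * (w x powr p * (indicator (cball x0 d) x * (e + ?t x) powr (- k))) \<le>
     M powr (p - m) * (l powr q * (V x * w x powr (p + 1)) +
       l powr (- q') * \<delta> * (indicator (cball x0 d) x * (e + ?t x) powr (- j)))" for x
  proof (cases "norm (x - x0) \<le> d")
    case True
    define h where "h = (e + ?t x) powr (- k)"
    have h: "h \<ge> 0" "h powr q' = (e + ?t x) powr (- j)" by (auto simp: h_def powr_powr jq)
    have "w x powr p = w x powr (p - m) * w x powr m" by (simp add: powr_add[symmetric])
    also have "\<dots> \<le> M powr (p - m) * w x powr m"
      using M nonneg m by (intro mult_right_mono powr_mono2) auto
    finally have 1: "w x powr p * h \<le> M powr (p - m) * (w x powr m * h)"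
      using h by (simp add: mult_right_mono mult.assoc[symmetric])
    \<comment> \<open>The factor \<open>l\<close> is inserted and removed again to unbalance Young's
      inequality: a small \<open>l\<close> shrinks the part without \<delta> at the expense of the
      part with it.\<close>
    have "w x powr m * h = (l * w x powr m) * (h / l)" using l by simp
    also have "\<dots> \<le> (l * w x powr m) powr q / q + (h / l) powr q' / q'"
      by (rule Youngs_inequality) (use q qq' l h in auto)
    also have "\<dots> \<le> (l * w x powr m) powr q + (h / l) powr q'"
    proof -
      have "a / b \<le> a" if "0 \<le> a" "1 < b" for a b :: real
        using divide_left_mono[of 1 b a] that by simp
      then show ?thesis using q by (intro add_mono) auto
    qed
    also have "(l * w x powr m) powr q = l powr q * w x powr (p + 1)"
      using l q by (simp add: powr_mult powr_powr)
    also have "(h / l) powr q' = l powr (- q') * (e + ?t x) powr (- j)"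
      using l h by (simp add: powr_divide powr_minus field_simps)
    finally have "w x powr p * h \<le> M powr (p - m) * (l powr q * w x powr (p + 1) + l powr (- q') * (e + ?t x) powr (- j))"
      using 1 mult_left_mono[of _ _ "M powr (p - m)"] by (meson order_trans powr_ge_zero)
    then have "V x * (w x powr p * h) \<le> V x * (M powr (p - m) * (l powr q * w x powr (p + 1) + l powr (- q') * (e + ?t x) powr (- j)))"
      by (intro mult_left_mono) (auto simp: Vw_nonneg)
    also have "\<dots> = M powr (p - m) * (l powr q * (V x * w x powr (p + 1)) + l powr (- q') * V x * (e + ?t x) powr (- j))"
      by (simp add: algebra_simps)
    also have "\<dots> \<le> M powr (p - m) * (l powr q * (V x * w x powr (p + 1)) + l powr (- q') * \<delta> * (e + ?t x) powr (- j))"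
      using V[OF True] by (intro mult_left_mono add_left_mono mult_right_mono) auto
    finally show ?thesis using True by (simp add: h_def dist_norm norm_minus_commute)
  next
    case False
    then show ?thesis by (simp add: dist_norm norm_minus_commute Vw_nonneg)
  qed
  have i1: "integrable lborel (\<lambda>x. indicator (cball x0 d) x * (e + ?t x) powr (- j))"
    using borel_integrable_compact[of "cball x0 d" "\<lambda>x. (e + ?t x) powr (- j)"] e
    by (force intro!: continuous_intros simp: add_nonneg_eq_0_iff)
  have i2: "integrable lborel (\<lambda>x. V x * w x powr (p + 1))" using integrable_V_powr p by simp
  have i3: "integrable lborel (\<lambda>x. V x * (w x powr p * (indicator (cball x0 d) x * (e + ?t x) powr (- k))))"
  proof (rule integrable_V[where C="M powr p * e powr (- k)"])
    have hb: "0 \<le> indicator (cball x0 d) x * (e + ?t x) powr (- k)"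
      "indicator (cball x0 d) x * (e + ?t x) powr (- k) \<le> e powr (- k)" for x
      using e k0 by (auto simp: indicator_def intro!: powr_mono2')
    have wb: "0 \<le> w x powr p" "w x powr p \<le> M powr p" for x
      using M nonneg p by (auto intro!: powr_mono2)
    show "\<bar>w x powr p * (indicator (cball x0 d) x * (e + ?t x) powr (- k))\<bar> \<le> M powr p * e powr (- k)" for x
      unfolding abs_mult[of "w x powr p"] abs_of_nonneg[OF hb(1)] abs_of_nonneg[OF wb(1)]
      by (intro mult_mono wb hb) auto
    show "(\<lambda>x. w x powr p * (indicator (cball x0 d) x * (e + ?t x) powr (- k))) \<in> borel_measurable borel"
      by (intro borel_measurable_times measurable_truncated_kernel) measurable
  qed (auto simp: zero_outside)
  have \<delta>: "\<delta> \<ge> 0" using V[of x0] d Vw_nonneg[of R \<alpha> "norm x0"] by simp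
  have "(LINT x|lborel. V x * (w x powr p * (indicator (cball x0 d) x * (e + ?t x) powr (- k)))) \<le>
     (LINT x|lborel. M powr (p - m) * (l powr q * (V x * w x powr (p + 1)) +
       l powr (- q') * \<delta> * (indicator (cball x0 d) x * (e + ?t x) powr (- j))))"
    by (intro integral_mono pt i3 integrable_mult_right Bochner_Integration.integrable_add i1 i2)
  also have "\<dots> = M powr (p - m) * (l powr q + l powr (- q') * \<delta> *
      (LINT x|lborel. indicator (cball x0 d) x * (e + ?t x) powr (- j)))"
    using i1 i2 by (simp add: integral_V_powr)
  also have "\<dots> \<le> M powr (p - m) * (l powr q + l powr (- q') * \<delta> *
      (N * (1 + j) * d powr (- 2 * j) * measure lborel (cball x0 d) / (N - 2 * j)))"
    using integral_Riesz_kernel_bound[OF d x0 e j0] j(2) \<delta>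
    by (intro mult_left_mono add_left_mono) (auto simp: N_def)
  finally show ?thesis by (simp add: q_def q'_def)
qed

end

section \<open>Conclusion\<close>

text \<open>Raise y \<le> exp y with y = s x / b to the power b. The choice b = |a| + 1 leaves at
  least one negative power of x to spare.\<close>

lemma powr_mult_exp_neg_le:
  fixes a s :: real
  assumes s: "s > 0"
  shows "\<exists>C>0. \<forall>x\<ge>1. x powr a * exp (- s * x) \<le> C / x"
proof -
  define b where "b = \<bar>a\<bar> + 1"
  have b: "b > 0" by (simp add: b_def)
  have "x powr a * exp (- s * x) \<le> (b / s) powr b / x" if x: "x \<ge> 1" for x
  proof -
    define y where "y = s * x / b"
    have y: "y > 0" using s x b by (simp add: y_def)
    have "y \<le> exp y" using exp_ge_add_one_self[of y] by linarith
    then have "exp (- y) \<le> 1 / y" using y by (simp add: exp_minus field_simps)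
    then have "exp (- y) powr b \<le> (1 / y) powr b" using b by (intro powr_mono2) auto
    then have "exp (- s * x) \<le> (1 / y) powr b"
      using b by (simp add: exp_powr_real y_def)
    also have "1 / y = (b / s) * (1 / x)" using b s x by (simp add: y_def)
    also have "((b / s) * (1 / x)) powr b = (b / s) powr b * x powr (- b)"
      using b s x by (simp add: powr_mult powr_divide powr_minus field_simps)
    finally have "x powr a * exp (- s * x) \<le> x powr a * ((b / s) powr b * x powr (- b))"
      by (intro mult_left_mono) auto
    also have "\<dots> = (b / s) powr b * x powr (a - b)"
      by (simp add: powr_diff powr_minus field_simps)
    also have "\<dots> \<le> (b / s) powr b * x powr (- 1)"
      using x by (intro mult_left_mono powr_mono) (auto simp: b_def)
    also have "\<dots> = (b / s) powr b / x" using x by (simp add: powr_minus field_simps)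
    finally show ?thesis .
  qed
  moreover have "(b / s) powr b > 0" using b s by simp
  ultimately show ?thesis by blast
qed

text \<open>Since \<alpha> \<ge> 1, the lower bound on M gives M^(-(p-1)) \<le> 40 S. Hence M^(p-m)
  is M times a negative power of M and at most M (40 S)^\<theta>, so the exponentially damped term
  is a small multiple of M and can be absorbed. The remaining bound M \<le> C sqrt S contradicts the
  growth of \<alpha>^2.\<close>

lemma growth_rates_incompatible:
  fixes c1 C1 C2 C3 s p m \<gamma> :: real
  assumes c: "c1 > 0" "C1 > 0" "C2 > 0" "C3 > 0" "s > 0" and p: "p > 1" and m: "p - 1 < m"
    and \<gamma>: "\<gamma> * (p + 1) / 2 < 2"
  shows "\<exists>A. \<forall>\<alpha>\<ge>A. \<forall>S M. 0 < S \<longrightarrow> 0 < M \<longrightarrow> S \<le> C3 * \<alpha> powr \<gamma> \<longrightarrow>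
     \<alpha>\<^sup>2 \<le> 40 * S * M powr (p - 1) \<longrightarrow>
     c1 * M \<le> C1 * sqrt S + C2 * S * M powr (p - m) * exp (- s * \<alpha>) \<longrightarrow> False"
proof -
  \<comment> \<open>Chosen so that \<open>(p - 1) * \<theta> = m - p + 1\<close>; its positivity is
    the condition \<open>p - 1 < m\<close>.\<close>
  define \<theta> where "\<theta> = (m - p + 1) / (p - 1)"
  have \<theta>: "\<theta> > 0" using p m by (simp add: \<theta>_def)
  obtain E where E: "E > 0" "\<And>x. x \<ge> 1 \<Longrightarrow> x powr (\<gamma> * (1 + \<theta>)) * exp (- s * x) \<le> E / x"
    using powr_mult_exp_neg_le[OF c(5), of "\<gamma> * (1 + \<theta>)"] by blast
  define F where "F = C2 * 40 powr \<theta> * C3 powr (1 + \<theta>) * E"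
  have F: "F > 0" using c E by (simp add: F_def)
  define D where "D = 40 * (2 * C1 / c1) powr (p - 1) * C3 powr ((p + 1) / 2)"
  have D: "D > 0" using c by (simp add: D_def)
  define \<eta> where "\<eta> = 2 - \<gamma> * (p + 1) / 2"
  have \<eta>: "\<eta> > 0" using \<gamma> by (simp add: \<eta>_def)
  \<comment> \<open>Three thresholds: \<alpha> \<ge> 1; F/\<alpha> \<le> c1/2, which absorbs the
    damped term; and \<alpha>^\<eta> > D, which contradicts the inequality \<alpha>^2 \<le> D
    \<alpha>^(2 - \<eta>) obtained after eliminating M and S.\<close>
  define A where "A = max (max 1 (2 * F / c1)) ((D + 1) powr (1 / \<eta>))"
  have False if \<alpha>: "\<alpha> \<ge> A" and S: "0 < S" "S \<le> C3 * \<alpha> powr \<gamma>" and M: "0 < M"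
    and low: "\<alpha>\<^sup>2 \<le> 40 * S * M powr (p - 1)"
    and up: "c1 * M \<le> C1 * sqrt S + C2 * S * M powr (p - m) * exp (- s * \<alpha>)" for \<alpha> S M
  proof -
    have \<alpha>': "\<alpha> \<ge> 1" "\<alpha> \<ge> 2 * F / c1" "\<alpha> \<ge> (D + 1) powr (1 / \<eta>)" using \<alpha> by (auto simp: A_def)
    have "1 \<le> \<alpha>\<^sup>2" using \<alpha>'(1) by simp
    then have "1 \<le> 40 * S * M powr (p - 1)" using low by linarith
    then have "M powr (- (p - 1)) \<le> 40 * S" 
      using M unfolding powr_minus_divide by (simp add: field_simps)
    then have "(M powr (- (p - 1))) powr \<theta> \<le> (40 * S) powr \<theta>" using \<theta> by (intro powr_mono2) auto
    moreover have "(p - 1) * \<theta> = m - p + 1" using p by (simp add: \<theta>_def)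
    then have "- (p - 1) * \<theta> = - (m - p + 1)" by (simp only: mult_minus_left)
    ultimately have Mneg: "M powr (- (m - p + 1)) \<le> (40 * S) powr \<theta>" by (simp only: powr_powr)
    have "C2 * S * M powr (p - m) * exp (- s * \<alpha>) = M * (C2 * S * M powr (- (m - p + 1)) * exp (- s * \<alpha>))"
      using powr_mult_base[of M "- (m - p + 1)"] M by (simp add: mult_ac)
    also have "\<dots> \<le> M * (C2 * S * (40 * S) powr \<theta> * exp (- s * \<alpha>))"
      using Mneg M S c by (intro mult_left_mono mult_right_mono) auto
    also have "\<dots> = M * (C2 * 40 powr \<theta> * S powr (1 + \<theta>) * exp (- s * \<alpha>))"
      using S by (simp add: powr_mult powr_add)
    also have "\<dots> \<le> M * (C2 * 40 powr \<theta> * (C3 * \<alpha> powr \<gamma>) powr (1 + \<theta>) * exp (- s * \<alpha>))"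
      using M S c \<theta> by (intro mult_left_mono mult_right_mono powr_mono2) auto
    also have "\<dots> = M * (C2 * 40 powr \<theta> * C3 powr (1 + \<theta>) * (\<alpha> powr (\<gamma> * (1 + \<theta>)) * exp (- s * \<alpha>)))"
      using c \<alpha>' by (simp add: powr_mult powr_powr mult_ac)
    also have "\<dots> \<le> M * (C2 * 40 powr \<theta> * C3 powr (1 + \<theta>) * (E / \<alpha>))"
      using M c by (intro mult_left_mono E(2) \<alpha>') auto
    also have "\<dots> = M * (F / \<alpha>)" by (simp add: F_def)
    also have "\<dots> \<le> M * (c1 / 2)"
      using M \<alpha>' c by (intro mult_left_mono) (auto simp: field_simps)
    finally have "c1 * M \<le> C1 * sqrt S + M * (c1 / 2)" using up by linarith
    then have "M \<le> (2 * C1 / c1) * sqrt S" using c by (simp add: field_simps)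
    then have "M powr (p - 1) \<le> ((2 * C1 / c1) * sqrt S) powr (p - 1)"
      using M p by (intro powr_mono2) auto
    also have "\<dots> = (2 * C1 / c1) powr (p - 1) * S powr ((p - 1) / 2)"
    proof -
      have "sqrt S powr (p - 1) = S powr ((p - 1) / 2)"
        using S by (simp add: powr_half_sqrt[symmetric] powr_powr)
      then show ?thesis using c S by (subst powr_mult) auto
    qed
    finally have "40 * S * M powr (p - 1) \<le> 40 * S * ((2 * C1 / c1) powr (p - 1) * S powr ((p - 1) / 2))"
      using S by (intro mult_left_mono) auto
    also have "\<dots> = 40 * (2 * C1 / c1) powr (p - 1) * S powr ((p + 1) / 2)"
    proof -
      have "S * S powr ((p - 1) / 2) = S powr ((p + 1) / 2)"
        using powr_mult_base[of S "(p - 1) / 2"] S by (simp add: field_simps)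
      then show ?thesis by (simp add: mult_ac)
    qed
    also have "\<dots> \<le> 40 * (2 * C1 / c1) powr (p - 1) * (C3 * \<alpha> powr \<gamma>) powr ((p + 1) / 2)"
      using S p by (intro mult_left_mono powr_mono2) auto
    also have "\<dots> = D * \<alpha> powr (\<gamma> * (p + 1) / 2)"
      using c by (simp add: D_def powr_mult powr_powr mult_ac)
    finally have "\<alpha> powr 2 \<le> D * \<alpha> powr (\<gamma> * (p + 1) / 2)" using low \<alpha>'(1) by simp
    moreover have "\<alpha> powr 2 = \<alpha> powr \<eta> * \<alpha> powr (\<gamma> * (p + 1) / 2)"
      by (simp add: powr_add[symmetric] \<eta>_def)
    ultimately have "\<alpha> powr \<eta> \<le> D" using \<alpha>'(1) by simp
    moreover have "((D + 1) powr (1 / \<eta>)) powr \<eta> \<le> \<alpha> powr \<eta>"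
      using \<alpha>'(3) \<eta> by (intro powr_mono2) auto
    then have "D + 1 \<le> \<alpha> powr \<eta>" using \<eta> D by (simp add: powr_powr)
    ultimately show False by simp
  qed
  then show ?thesis by blast
qed

text \<open>The threshold is uniform over all minimisers and all points of the annulus: it is fixed
  before \<open>w\<close> and \<open>x0\<close>, since every constant comes from the dimension,
  \<open>p\<close>, \<open>R\<close> and \<open>d\<close> alone.\<close>

lemma maximum_not_in_interior_annulus:
  fixes p R d :: real
  assumes N3: "CARD('n) \<ge> 3" and p: "1 < p" "p < (real CARD('n) + 2) / (real CARD('n) - 2)"
    and R: "0 < R" "R < 1" and d: "d > 0"
  shows "\<exists>A. \<forall>\<alpha>\<ge>A. \<forall>(w :: real^'n \<Rightarrow> real) x0. pos_minimiser R \<alpha> p w \<longrightarrow>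
     2 * d \<le> norm x0 \<longrightarrow> norm x0 \<le> 1 - 2 * d \<longrightarrow> (\<exists>x\<in>cball 0 1. w x0 < w x)"
proof -
  define N where "N = real CARD('n)"
  define k where "k = (N - 2) / 2"
  have N: "N \<ge> 3" using N3 by (simp add: N_def)
  have k: "k > 0" using N by (simp add: k_def)
  have "p * (N - 2) < N + 2" using p(2) N by (simp add: N_def field_simps)
  then have "p - 1 < 2 * (p + 1) / N" using N by (simp add: field_simps)
  \<comment> \<open>The lower bound on \<open>m\<close> permits absorption into the maximum;
    \<open>m < 2 * (p + 1) / N\<close> is equivalent to \<open>2 * j < N\<close> below, the
    integrability of the kernel power. Subcriticality leaves room between the two.\<close>
  then obtain m where m: "p - 1 < m" "m < min p (2 * (p + 1) / N)"
    using dense[of "p - 1" "min p (2 * (p + 1) / N)"] by auto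
  have m': "0 < m" "m \<le> p" "N * m < 2 * (p + 1)" using m p N by (auto simp: field_simps)
  define q where "q = (p + 1) / m"
  define q' where "q' = (p + 1) / (p + 1 - m)"
  have q: "q > 0" "q' > 0" using m' p by (auto simp: q_def q'_def)
  define j where "j = k * q'"
  have j: "0 < j" "2 * j < N"
  proof -
    show "0 < j" using k q by (simp add: j_def)
    have "(N - 2) * (p + 1) < N * (p + 1 - m)" using m'(3) by (simp add: algebra_simps)
    then show "2 * j < N" using m' p by (simp add: j_def k_def q'_def field_simps)
  qed
  define \<omega> where "\<omega> = unit_ball_vol N"
  have \<omega>: "\<omega> > 0" using N by (simp add: \<omega>_def)
  define c1 where "c1 = N * k * 2 powr (- k - 2) * \<omega>"
  define C0 where "C0 = 2 * N * k * (k + 2) * (d\<^sup>2) powr (- k - 1)"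
  define C1 where "C1 = C0 * (2 * sqrt \<omega>)"
  define C6 where "C6 = N * (1 + j) * d powr (- 2 * j) * (\<omega> * d powr N) / (N - 2 * j)"
  define C2 where "C2 = 1 + C6"
  \<comment> \<open>The two parts of Young's inequality decay at rates
    \<open>d / 2 * (q / q')\<close> and \<open>d / 2\<close>; \<open>s\<close> is the smaller
    one.\<close>
  define s where "s = d / 2 * min 1 (q / q')"
  have pos: "c1 > 0" "C0 > 0" "C1 > 0" "C6 > 0" "C2 > 0" "s > 0"
    using N k d j q \<omega> by (auto simp: c1_def C0_def C1_def C6_def C2_def s_def intro!: add_pos_pos)
  define \<gamma> where "\<gamma> = 2 - N + 2 * N / (p + 1)"
  have "\<gamma> * (p + 1) = (2 - N) * (p + 1) + 2 * N" using p by (simp add: \<gamma>_def field_simps)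
  then have "\<gamma> * (p + 1) = 4 - (N - 2) * (p - 1)" by (simp add: algebra_simps)
  moreover have "(N - 2) * (p - 1) > 0" using N p by simp
  ultimately have \<gamma>: "\<gamma> * (p + 1) / 2 < 2" by simp
  obtain C3 where C3: "C3 > 0" "\<And>\<alpha>. \<alpha> \<ge> 2 \<Longrightarrow> S_const TYPE('n) R \<alpha> p \<le> C3 * \<alpha> powr \<gamma>"
    using S_const_upper_bound[where 'n='n, OF p(1) R] unfolding \<gamma>_def N_def by blast
  obtain A where A: "\<And>\<alpha> S M. \<alpha> \<ge> A \<Longrightarrow> 0 < S \<Longrightarrow> 0 < M \<Longrightarrow> S \<le> C3 * \<alpha> powr \<gamma> \<Longrightarrow>
     \<alpha>\<^sup>2 \<le> 40 * S * M powr (p - 1) \<Longrightarrow>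
     c1 * M \<le> C1 * sqrt S + C2 * S * M powr (p - m) * exp (- s * \<alpha>) \<Longrightarrow> False"
    using growth_rates_incompatible[OF pos(1,3,5) C3(1) pos(6) p(1) m(1) \<gamma>] by blast
  have False if \<alpha>: "\<alpha> \<ge> max 2 A" and w: "pos_minimiser R \<alpha> p w"
    and x0: "2 * d \<le> norm x0" "norm x0 \<le> 1 - 2 * d"
    and max: "\<And>x. x \<in> cball 0 1 \<Longrightarrow> w x \<le> w x0" for \<alpha> and w :: "real^'n \<Rightarrow> real" and x0
  proof -
    obtain g where g: "H10 w g" "wterm R \<alpha> p w = 1" "rayleigh R \<alpha> p w g = S_const TYPE('n) R \<alpha> p"
      "continuous_on (cball 0 1) w" "\<And>x. x \<in> ball 0 1 \<Longrightarrow> w x > 0"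
      using w unfolding pos_minimiser_def by blast
    have \<alpha>2: "2 \<le> \<alpha>" "A \<le> \<alpha>" using \<alpha> by auto
    interpret normalized_minimiser R \<alpha> p w g
      by unfold_locales (use N3 p R \<alpha> g in auto)
    define M where "M = w x0"
    have nx0: "norm x0 < 1" using x0 d by linarith
    have M0: "M > 0" using pos[OF nx0] by (simp add: M_def)
    have M: "w x \<le> M" for x
      using max[of x] zero_outside[of x] M0 by (cases "norm x \<le> 1") (auto simp: M_def)
    have S: "0 < S" "S \<le> C3 * \<alpha> powr \<gamma>" using minimum_pos C3(2)[of \<alpha>] \<alpha>2 by (auto simp: S_const_eq)
    have x0d: "norm x0 + d < 1" using x0 d by linarith
    have "isCont w x0"
      using g(4) nx0 by (intro continuous_on_interior) (auto simp: interior_cball)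
    then obtain r where r: "r > 0" "\<And>x. dist x x0 < r \<Longrightarrow> dist (w x) (w x0) < M / 2"
      using M0 unfolding continuous_at_eps_delta by (metis half_gt_zero)
    \<comment> \<open>Squared so that \<open>sqrt e\<close> lies below both the continuity radius of
      \<open>w\<close> at \<open>x0\<close> and \<open>d\<close>. The dependence on \<open>w\<close>
      is harmless, as no later constant contains \<open>e\<close>.\<close>
    define e where "e = (min (r / 2) d)\<^sup>2"
    have e: "e > 0" "sqrt e \<le> d" "sqrt e < r" using r d by (auto simp: e_def)
    have low: "M / 2 \<le> w x" if "norm (x - x0) \<le> sqrt e" for x
    proof -
      have "dist (w x) (w x0) < M / 2" by (rule r(2)) (use that e(3) in \<open>simp add: dist_norm\<close>)
      then have "\<bar>w x - M\<bar> < M / 2" by (simp add: dist_real_def M_def)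
      then show ?thesis by linarith
    qed
    have 1: "c1 * M \<le> C0 * (LINT x|lborel. w x) +
       S * (LINT x|lborel. V x * (w x powr p * (indicator (cball x0 d) x * (e + (norm (x - x0))\<^sup>2) powr (- k))))"
      unfolding c1_def C0_def \<omega>_def k_def N_def
      using pointwise_le_mean_plus_potential[OF e(1,2) low _ x0d] M0 by simp
    have V\<delta>: "V x \<le> exp (- \<alpha> * d)" if "norm (x - x0) \<le> d" for x
    proof -
      have "norm x0 - d \<le> norm x" using norm_triangle_ineq3[of x0 x] that by (simp add: norm_minus_commute)
      moreover have "norm x \<le> norm x0 + d" using norm_triangle_ineq2[of x x0] that by linarith
      ultimately have nx: "d \<le> norm x" "norm x \<le> 1 - d" using x0 by linarith+
      have "V x \<le> exp (- \<alpha> * (if norm x < R then norm x else 1 - norm x))"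
        by (rule Vw_le_exp) (use R \<alpha>2 nx d in auto)
      also have "\<dots> \<le> exp (- \<alpha> * d)" using nx \<alpha>2 by auto
      finally show ?thesis .
    qed
    \<comment> \<open>With this choice \<open>l powr (- q')\<close> uses up half of the decay
      \<open>exp (- \<alpha> * d)\<close> of the weight, while \<open>l powr q\<close> is itself
      exponentially small.\<close>
    define l where "l = exp (- \<alpha> * d / (2 * q'))"
    have l: "l powr q = exp (- (d / 2 * (q / q')) * \<alpha>)" "l powr (- q') = exp (\<alpha> * d / 2)"
      using q by (auto simp: l_def exp_powr_real field_simps)
    have "(LINT x|lborel. V x * (w x powr p * (indicator (cball x0 d) x * (e + (norm (x - x0))\<^sup>2) powr (- k))))
       \<le> M powr (p - m) * (l powr q + l powr (- q') * exp (- \<alpha> * d) * C6)"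
      using potential_le[OF M d x0d e(1) V\<delta> m'(1,2), of j l] j measure_lborel_cball[of d x0] d
      by (simp add: C6_def q_def q'_def k_def N_def \<omega>_def j_def l_def)
    also have "l powr (- q') * exp (- \<alpha> * d) = exp (- (d / 2) * \<alpha>)"
      unfolding l by (simp add: exp_add[symmetric] field_simps)
    also have "l powr q \<le> exp (- s * \<alpha>)"
    proof -
      have "s \<le> d / 2 * (q / q')" unfolding s_def using d by (intro mult_left_mono) auto
      then have "s * \<alpha> \<le> d / 2 * (q / q') * \<alpha>" by (rule mult_right_mono) (use \<alpha>2 in simp)
      then show ?thesis unfolding l by (simp only: exp_le_cancel_iff mult_minus_left neg_le_iff_le)
    qed
    also have "exp (- (d / 2) * \<alpha>) \<le> exp (- s * \<alpha>)"
    proof -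
      have "s \<le> d / 2 * 1" unfolding s_def using d by (intro mult_left_mono) auto
      then show ?thesis using \<alpha>2 by (simp add: mult_right_mono)
    qed
    finally have "(LINT x|lborel. V x * (w x powr p * (indicator (cball x0 d) x * (e + (norm (x - x0))\<^sup>2) powr (- k))))
       \<le> M powr (p - m) * (C2 * exp (- s * \<alpha>))"
      using \<open>C6 > 0\<close> by (simp add: C2_def algebra_simps mult_right_mono mult_left_mono)
    then have 2: "S * (LINT x|lborel. V x * (w x powr p * (indicator (cball x0 d) x * (e + (norm (x - x0))\<^sup>2) powr (- k))))
       \<le> C2 * S * M powr (p - m) * exp (- s * \<alpha>)"
      using mult_left_mono[of _ _ S] S by (fastforce simp: mult_ac)
    have "C0 * (LINT x|lborel. w x) \<le> C0 * (2 * sqrt S * sqrt \<omega>)"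
      using integral_le_sqrt_minimum measure_lborel_cball[of 1 "0::real^'n"] \<open>C0 > 0\<close>
      by (intro mult_left_mono) (auto simp: \<omega>_def N_def)
    also have "\<dots> = C1 * sqrt S" by (simp add: C1_def)
    finally have "c1 * M \<le> C1 * sqrt S + C2 * S * M powr (p - m) * exp (- s * \<alpha>)"
      using 1 2 by linarith
    then show False using A[OF _ S(1) M0 S(2) max_lower_bound[OF M]] \<alpha>2 by simp
  qed
  then show ?thesis by (intro exI[of _ "max 2 A"]) (meson not_le)
qed

text \<open>A limit of points on the axis has the form r e_1 with r in [0,1]. If 0 < r < 1, the
  maximum points along the sequence eventually stay in a fixed annulus away from the origin and the
  sphere, which is excluded for large \<alpha>.\<close>

theorem mainTheorem4:
  fixes u :: "real \<Rightarrow> real^'n \<Rightarrow> real"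
    and s \<beta> :: "real \<Rightarrow> real"
    and i1 :: 'n
    and p R :: real
  assumes N3: "CARD('n) \<ge> 3"
    and p_gt: "1 < p"
    and p_lt: "p < (real CARD('n) + 2) / (real CARD('n) - 2)"
    and R: "0 < R" "R < 1"
    and gs: "\<And>\<alpha>. \<alpha> > 0 \<Longrightarrow> groundstate R \<alpha> p (u \<alpha>)"
    and s_rng: "\<And>\<alpha>. \<alpha> > 0 \<Longrightarrow> 0 \<le> s \<alpha> \<and> s \<alpha> < 1"
    and max_at: "\<And>\<alpha> y. \<alpha> > 0 \<Longrightarrow> y \<in> cball 0 1 \<Longrightarrow> u \<alpha> y \<le> u \<alpha> (s \<alpha> *\<^sub>R axis i1 1)"
    and beta_def: "\<And>\<alpha>. \<alpha> > 0 \<Longrightarrow> \<beta> \<alpha> = u \<alpha> (s \<alpha> *\<^sub>R axis i1 1)"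
    and liminf: "Liminf at_top (\<lambda>\<alpha>. ereal (\<alpha> powr (2 / (p - 1)) / \<beta> \<alpha>)) < \<infinity>"
  shows "\<forall>z :: real^'n. (\<exists>a :: nat \<Rightarrow> real. filterlim a at_top sequentially \<and>
                 (\<lambda>k. s (a k) *\<^sub>R axis i1 1) \<longlonglongrightarrow> z)
             \<longrightarrow> z = 0 \<or> z = axis i1 1"
proof (intro allI impI, elim exE conjE)
  fix z :: "real^'n" and a :: "nat \<Rightarrow> real"
  assume a: "filterlim a at_top sequentially" and z: "(\<lambda>k. s (a k) *\<^sub>R axis i1 1) \<longlonglongrightarrow> z"
  define r where "r = z $ i1"
  have "(\<lambda>k. (s (a k) *\<^sub>R axis i1 1 :: real^'n) $ i1) \<longlonglongrightarrow> r"
    unfolding r_def using tendsto_vec_nth[OF z] .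
  then have sr: "(\<lambda>k. s (a k)) \<longlonglongrightarrow> r" by simp
  have zr: "z = r *\<^sub>R axis i1 1"
    by (rule LIMSEQ_unique[OF z tendsto_scaleR[OF sr tendsto_const]])
  have ev0: "eventually (\<lambda>k. a k > 0) sequentially"
    using a by (simp add: filterlim_at_top_dense)
  have r01: "0 \<le> r" "r \<le> 1"
    using tendsto_lowerbound[OF sr eventually_mono[OF ev0]] tendsto_upperbound[OF sr eventually_mono[OF ev0]] s_rng
    by (auto intro: less_imp_le)
  have "r = 0 \<or> r = 1"
  proof (rule ccontr)
    assume "\<not> (r = 0 \<or> r = 1)"
    then have r: "0 < r" "r < 1" using r01 by auto
    \<comment> \<open>With a quarter, being within \<open>d\<close> of \<open>r\<close> still leaves
      distance at least \<open>3 * d\<close> to both 0 and 1, more than the \<open>2 * d\<close>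
      needed.\<close>
    define d where "d = min r (1 - r) / 4"
    have d: "d > 0" "4 * d \<le> r" "r \<le> 1 - 4 * d" using r by (auto simp: d_def)
    obtain A where A: "\<And>\<alpha> (w :: real^'n \<Rightarrow> real) x0. \<alpha> \<ge> A \<Longrightarrow> pos_minimiser R \<alpha> p w \<Longrightarrow>
       2 * d \<le> norm x0 \<Longrightarrow> norm x0 \<le> 1 - 2 * d \<Longrightarrow> \<exists>x\<in>cball 0 1. w x0 < w x"
      using maximum_not_in_interior_annulus[OF N3 p_gt p_lt R d(1)] by blast
    have "eventually (\<lambda>k. a k \<ge> A) sequentially" using a by (simp add: filterlim_at_top)
    moreover have "eventually (\<lambda>k. dist (s (a k)) r < d) sequentially" using sr d(1) by (rule tendstoD)
    ultimately have "eventually (\<lambda>k. a k > 0 \<and> a k \<ge> A \<and> dist (s (a k)) r < d) sequentially"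
      using ev0 by eventually_elim auto
    then obtain n where n: "a n > 0" "a n \<ge> A" "dist (s (a n)) r < d"
      using eventually_happens'[OF sequentially_bot] by blast
    define \<alpha> where "\<alpha> = a n"
    define x0 :: "real^'n" where "x0 = s \<alpha> *\<^sub>R axis i1 1"
    have nx0: "norm x0 = s \<alpha>" using s_rng[OF n(1)] by (simp add: x0_def \<alpha>_def norm_axis_1)
    have "\<bar>s \<alpha> - r\<bar> < d" using n(3) by (simp add: \<alpha>_def dist_real_def)
    then have x0: "2 * d \<le> norm x0" "norm x0 \<le> 1 - 2 * d" using d nx0 by auto
    obtain w where w: "pos_minimiser R \<alpha> p w"
      "u \<alpha> = (\<lambda>x. S_const TYPE('n) R \<alpha> p powr (1 / (p - 1)) * w x)"
      using gs[OF n(1)] unfolding groundstate_def \<alpha>_def by blast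
    obtain x where x: "x \<in> cball 0 1" "w x0 < w x" using A[OF _ w(1) x0] n(2) by (auto simp: \<alpha>_def)
    obtain g where g: "H10 w g" "wterm R \<alpha> p w = 1" "rayleigh R \<alpha> p w g = S_const TYPE('n) R \<alpha> p"
      "continuous_on (cball 0 1) w" "\<And>x. x \<in> ball 0 1 \<Longrightarrow> w x > 0"
      using w(1) unfolding pos_minimiser_def by blast
    interpret normalized_minimiser R \<alpha> p w g
      by unfold_locales (use N3 p_gt R n(1) g \<alpha>_def in auto)
    \<comment> \<open>The groundstate is a multiple of the minimiser; strict positivity of the
      factor transfers the strict inequality at \<open>x\<close> to
      \<open>u \<alpha>\<close>.\<close>
    have "S_const TYPE('n) R \<alpha> p powr (1 / (p - 1)) > 0" using minimum_pos by (simp add: S_const_eq)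
    then have "u \<alpha> x0 < u \<alpha> x" using x(2) by (simp add: w(2))
    then show False using max_at[OF n(1) x(1)] by (simp add: \<alpha>_def x0_def)
  qed
  then show "z = 0 \<or> z = axis i1 1" using zr by auto
qed

end
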